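(* Let $n\ge 60$, let $t_1,\dots,t_n\in[0,1]$ be distinct, and let $\rho,l,\lambda,\gamma,\sigma>0$ and $\bm y\in\mathbb{R}^n$ be fixed. Let $\mathcal R_{\lambda\gamma\phi}(\bm x,\bm\theta)$ be the ODIN risk and $\tilde{\mathcal R}_{\lambda\gamma\phi}(\bm x,\bm\theta)$ its approximation obtained with quadrature Fourier features of order $m$ (both defined in the context), with $\phi=(\rho,l)$. Put $\bar\rho:=\max(\rho,1)$, $\bar l:=\min(l,1)$, $\bar\lambda:=\min(\lambda,1)$, $\bar\gamma:=\min(\gamma,1)$. Let $0<\epsilon<1$. If the integer $m$ satisfies $$m\ \ge\ 10+\max\left\{\frac{e}{2\bar l^{\,2}},\ \log_2\!\left(\frac{\bar\rho^{\,2}n^3}{\bar\lambda^{2}\,\bar\gamma\,\bar l^{\,4}\,\epsilon}\right)\right\},$$ then $$\frac{|\mathcal R_{\lambda\gamma\phi}(\bm x,\bm\theta)-\tilde{\mathcal R}_{\lambda\gamma\phi}(\bm x,\bm\theta)|}{\mathcal R_{\lambda\gamma\phi}(\bm x,\bm\theta)}\le\epsilon$$ for all $\bm x\in\mathbb{R}^n$ and all $\bm\theta$ (for which $\mathcal R_{\lambda\gamma\phi}(\bm x,\bm\theta)\neq 0$).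
   Context: Kernel: $k(x,y)=\rho\,e^{-(x-y)^2/(2l^2)}$. Define the $n\times n$ matrices $\bm C,{}'\bm C,\bm C',\bm C''$ with $(i,j)$ entries $k(t_i,t_j)$, $\partial_x k(x,y)|_{(t_i,t_j)}$, $\partial_y k(x,y)|_{(t_i,t_j)}$, $\partial_x\partial_y k(x,y)|_{(t_i,t_j)}$ respectively. Set $\bm D={}'\bm C(\bm C+\lambda \bm I)^{-1}$ and $\bm A=\bm C''-{}'\bm C(\bm C+\lambda\bm I)^{-1}\bm C'$. Risk: $\bm f(\bm x,\bm\theta)\in\mathbb{R}^n$ is an arbitrary given function of $\bm x\in\mathbb{R}^n$ and a parameter $\bm\theta$ (the right-hand side of the ODE $\dot x=f(x,\bm\theta)$ evaluated at the entries of $\bm x$), and $$\mathcal R_{\lambda\gamma\phi}(\bm x,\bm\theta)=\bm x^T(\bm C+\lambda\bm I)^{-1}\bm x+(\bm x-\bm y)^T\sigma^{-2}(\bm x-\bm y)+(\bm f(\bm x,\bm\theta)-\bm D\bm x)^T(\bm A+\gamma\bm I)^{-1}(\bm f(\bm x,\bm\theta)-\bm D\bm x).$$ Approximation of order $m$: let $\omega_1^m,\dots,\omega_m^m$ and $W_1^m,\dots,W_m^m>0$ be the abscissas and weights of the $m$-point Gauss–Hermite quadrature rule for the weight $e^{-\omega^2}$ on $\mathbb{R}$ (abscissas are the zeros of the Hermite polynomial $H_m$; the rule is exact for polynomials of degree at most $2m-1$). Let $\bm\phi(t)\in\mathbb{R}^{2m}$ consist, for each $q=1,\dots,m$, of $\sqrt{\rho/\sqrt\pi}\,\sqrt{W_q^m}\cos(\omega_q^m\tfrac{\sqrt2}{l}t)$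 and $\sqrt{\rho/\sqrt\pi}\,\sqrt{W_q^m}\sin(\omega_q^m\tfrac{\sqrt2}{l}t)$, and let $\bm\phi(t)'$ be its derivative in $t$. Let $\bm\Phi,\bm\Phi'\in\mathbb{R}^{2m\times n}$ have columns $\bm\phi(t_i)$ and $\bm\phi(t_i)'$. Set $\tilde{\bm C}=\bm\Phi^T\bm\Phi$, ${}'\tilde{\bm C}=\bm\Phi'^{\,T}\bm\Phi$, $\tilde{\bm C}'=\bm\Phi^T\bm\Phi'$, $\tilde{\bm C}''=\bm\Phi'^{\,T}\bm\Phi'$, $\tilde{\bm D}={}'\tilde{\bm C}(\tilde{\bm C}+\lambda\bm I)^{-1}$, $\tilde{\bm A}=\tilde{\bm C}''-{}'\tilde{\bm C}(\tilde{\bm C}+\lambda\bm I)^{-1}\tilde{\bm C}'$. Then $\tilde{\mathcal R}_{\lambda\gamma\phi}$ is defined by the same formula as $\mathcal R_{\lambda\gamma\phi}$ with $\bm C,\bm D,\bm A$ replaced by $\tilde{\bm C},\tilde{\bm D},\tilde{\bm A}$. *)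

theory Defs
  imports "HOL-Analysis.Analysis" "HOL-Computational_Algebra.Polynomial"
begin

section \<open>The squared exponential kernel and its derivative matrices\<close>

definition rbf_kernel :: "real \<Rightarrow> real \<Rightarrow> real \<Rightarrow> real \<Rightarrow> real" where
  "rbf_kernel \<rho> l x y = \<rho> * exp (- ((x - y)\<^sup>2 / (2 * l\<^sup>2)))"

definition kernel_mat :: "real \<Rightarrow> real \<Rightarrow> real^'n \<Rightarrow> real^'n^'n" where
  "kernel_mat \<rho> l t = (\<chi> i j. rbf_kernel \<rho> l (t $ i) (t $ j))"

definition kernel_mat_dx :: "real \<Rightarrow> real \<Rightarrow> real^'n \<Rightarrow> real^'n^'n" where
  "kernel_mat_dx \<rho> l t = (\<chi> i j. deriv (\<lambda>x. rbf_kernel \<rho> l x (t $ j)) (t $ i))"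

definition kernel_mat_dy :: "real \<Rightarrow> real \<Rightarrow> real^'n \<Rightarrow> real^'n^'n" where
  "kernel_mat_dy \<rho> l t = (\<chi> i j. deriv (\<lambda>y. rbf_kernel \<rho> l (t $ i) y) (t $ j))"

definition kernel_mat_dxdy :: "real \<Rightarrow> real \<Rightarrow> real^'n \<Rightarrow> real^'n^'n" where
  "kernel_mat_dxdy \<rho> l t =
     (\<chi> i j. deriv (\<lambda>x. deriv (\<lambda>y. rbf_kernel \<rho> l x y) (t $ j)) (t $ i))"


section \<open>Gauss--Hermite quadrature\<close>

text \<open>
  Physicists' Hermite polynomials, orthogonal for the weight \<open>exp (- x\<^sup>2)\<close>.  The recursion is
  obtained by differentiating Rodrigues' formula
  \<open>H k x * exp (- x\<^sup>2) = (- 1) ^ k * (d/dx) ^ k (exp (- x\<^sup>2))\<close> once.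
\<close>

fun hermite_poly :: "nat \<Rightarrow> real poly" where
  "hermite_poly 0 = 1"
| "hermite_poly (Suc k) = [:0, 2:] * hermite_poly k - pderiv (hermite_poly k)"

text \<open>
  The number \<open>m\<close> of nodes is \<open>CARD('m)\<close>; the order in which nodes are listed is irrelevant.
\<close>

definition gauss_hermite_rule :: "real^'m \<Rightarrow> real^'m \<Rightarrow> bool" where
  "gauss_hermite_rule \<omega> W \<longleftrightarrow>
     inj (\<lambda>q. \<omega> $ q) \<and>
     range (\<lambda>q. \<omega> $ q) = {x. poly (hermite_poly CARD('m)) x = 0} \<and>
     (\<forall>q. W $ q > 0) \<and>
     (\<forall>p :: real poly. degree p \<le> 2 * CARD('m) - 1 \<longrightarrow>
        has_bochner_integral lborel (\<lambda>x. exp (- (x\<^sup>2)) * poly p x)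
          (\<Sum>q\<in>UNIV. W $ q * poly p (\<omega> $ q)))"


section \<open>Quadrature Fourier features\<close>

text \<open>
  The \<open>2 * m\<close> feature coordinates are indexed by \<open>'m + 'm\<close>: cosines on the left, sines on the
  right.  Their order does not affect the products below.
\<close>

definition qff :: "real \<Rightarrow> real \<Rightarrow> real^'m \<Rightarrow> real^'m \<Rightarrow> real \<Rightarrow> real^('m + 'm)" where
  "qff \<rho> l \<omega> W s = (\<chi> a. case a of
       Inl q \<Rightarrow> sqrt (\<rho> / sqrt pi) * sqrt (W $ q) * cos (\<omega> $ q * (sqrt 2 / l) * s)
     | Inr q \<Rightarrow> sqrt (\<rho> / sqrt pi) * sqrt (W $ q) * sin (\<omega> $ q * (sqrt 2 / l) * s))"

definition qff_mat ::
    "real \<Rightarrow> real \<Rightarrow> real^'m \<Rightarrow> real^'m \<Rightarrow> real^'n \<Rightarrow> real^'n^('m + 'm)" where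
  "qff_mat \<rho> l \<omega> W t = (\<chi> a i. qff \<rho> l \<omega> W (t $ i) $ a)"

definition qff_mat_deriv ::
    "real \<Rightarrow> real \<Rightarrow> real^'m \<Rightarrow> real^'m \<Rightarrow> real^'n \<Rightarrow> real^'n^('m + 'm)" where
  "qff_mat_deriv \<rho> l \<omega> W t =
     (\<chi> a i. vector_derivative (qff \<rho> l \<omega> W) (at (t $ i)) $ a)"


section \<open>The risk and its approximation\<close>

text \<open>
  \<open>K\<close>, \<open>Kx\<close>, \<open>Ky\<close>, \<open>Kxy\<close> are the kernel matrix and its derivatives in the first, the second,
  and both arguments.  Note that \<open>mat c\<close> is \<open>c\<close> times the identity matrix.
\<close>

definition D_mat :: "real \<Rightarrow> real^'n^'n \<Rightarrow> real^'n^'n \<Rightarrow> real^'n^'n" where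
  "D_mat lam K Kx = Kx ** matrix_inv (K + mat lam)"

definition A_mat ::
    "real \<Rightarrow> real^'n^'n \<Rightarrow> real^'n^'n \<Rightarrow> real^'n^'n \<Rightarrow> real^'n^'n \<Rightarrow> real^'n^'n" where
  "A_mat lam K Kx Ky Kxy = Kxy - Kx ** matrix_inv (K + mat lam) ** Ky"

definition risk_form ::
    "real^'n^'n \<Rightarrow> real^'n^'n \<Rightarrow> real^'n^'n \<Rightarrow> real \<Rightarrow> real \<Rightarrow> real \<Rightarrow> real^'n \<Rightarrow>
     (real^'n \<Rightarrow> 'p \<Rightarrow> real^'n) \<Rightarrow> real^'n \<Rightarrow> 'p \<Rightarrow> real" where
  "risk_form C D A lam \<gamma> \<sigma> y f x \<theta> =
     x \<bullet> (matrix_inv (C + mat lam) *v x)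
     + (x - y) \<bullet> (inverse (\<sigma>\<^sup>2) *\<^sub>R (x - y))
     + (f x \<theta> - D *v x) \<bullet> (matrix_inv (A + mat \<gamma>) *v (f x \<theta> - D *v x))"

definition odin_risk ::
    "real \<Rightarrow> real \<Rightarrow> real^'n \<Rightarrow> real \<Rightarrow> real \<Rightarrow> real \<Rightarrow> real^'n \<Rightarrow>
     (real^'n \<Rightarrow> 'p \<Rightarrow> real^'n) \<Rightarrow> real^'n \<Rightarrow> 'p \<Rightarrow> real" where
  "odin_risk \<rho> l t lam \<gamma> \<sigma> y f x \<theta> =
     (let C = kernel_mat \<rho> l t;
          Cx = kernel_mat_dx \<rho> l t;
          Cy = kernel_mat_dy \<rho> l t;
          Cxy = kernel_mat_dxdy \<rho> l t
      in risk_form C (D_mat lam C Cx) (A_mat lam C Cx Cy Cxy) lam \<gamma> \<sigma> y f x \<theta>)"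

definition odin_risk_qff ::
    "real^'m \<Rightarrow> real^'m \<Rightarrow> real \<Rightarrow> real \<Rightarrow> real^'n \<Rightarrow> real \<Rightarrow> real \<Rightarrow> real \<Rightarrow> real^'n \<Rightarrow>
     (real^'n \<Rightarrow> 'p \<Rightarrow> real^'n) \<Rightarrow> real^'n \<Rightarrow> 'p \<Rightarrow> real" where
  "odin_risk_qff \<omega> W \<rho> l t lam \<gamma> \<sigma> y f x \<theta> =
     (let P = qff_mat \<rho> l \<omega> W t;
          P' = qff_mat_deriv \<rho> l \<omega> W t;
          C = transpose P ** P;
          Cx = transpose P' ** P;
          Cy = transpose P ** P';
          Cxy = transpose P' ** P'
      in risk_form C (D_mat lam C Cx) (A_mat lam C Cx Cy Cxy) lam \<gamma> \<sigma> y f x \<theta>)"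

end

theory Submission
  imports Defs "HOL-Probability.Probability" "HOL-Real_Asymp.Real_Asymp"
begin

text \<open>
  By completing squares, the kernel part of the risk is the quadratic form of the inverse of the
  regularised joint covariance matrix of states and derivatives,
  \<open>sup (2 (p \<bullet> x + q \<bullet> f) - M p q)\<close> over \<open>p, q\<close>. If the approximate form \<open>M'\<close> satisfies
  \<open>\<bar>M' - M\<bar> \<le> \<tau> M\<close>, the two suprema differ by at most the factor \<open>\<tau> / (1 - \<tau>)\<close>. The unregularised
  form is positive semidefinite, so \<open>M p q \<ge> min \<lambda> \<gamma> (p \<bullet> p + q \<bullet> q)\<close> and it suffices to bound the
  entrywise errors, which are Gauss--Hermite errors of \<open>cos (b r w)\<close>, \<open>b w sin (b r w)\<close> and
  \<open>b\<^sup>2 w\<^sup>2 cos (b r w)\<close> with \<open>b = sqrt 2 / l\<close> and \<open>\<bar>r\<bar> \<le> 1\<close>.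

  Comparison with the Hermite interpolant shows that the quadrature sum of \<open>F\<close> is at most its Gaussian
  integral as soon as the derivative of order \<open>2 m\<close> of \<open>F\<close> is nonnegative. The last two functions have
  unbounded derivatives, but these are at most \<open>8 m\<^sup>2 b ^ (2 m) (1 + w\<^sup>2)\<close>, which is the derivative of a
  combination of squares of the Hermite polynomials of degree \<open>m\<close> and \<open>m + 1\<close> with small Gaussian
  integral. Since \<open>fact m / fact (2 m) \<le> (e / (4 m)) ^ m\<close>, the assumption \<open>m \<ge> e / (2 l\<^sup>2)\<close> makes all
  errors of order \<open>\<rho> 2 ^ (- m) / l ^ 4\<close>; the factor \<open>m\<^sup>2\<close> is absorbed by \<open>(e / (2 l\<^sup>2 m))\<^sup>2\<close>.
\<close>

section \<open>Gaussian integrals\<close>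

definition gauss_int :: "(real \<Rightarrow> real) \<Rightarrow> real" where
  "gauss_int f = (LINT x|lborel. exp (- x\<^sup>2) * f x)"

text \<open>Closed under sums and products, and large enough to contain polynomials times trigonometric
  functions; it settles all integrability and boundary conditions for the weight \<open>exp (- x\<^sup>2)\<close>.\<close>

definition exp_bounded :: "(real \<Rightarrow> real) \<Rightarrow> bool" where
  "exp_bounded f \<longleftrightarrow> continuous_on UNIV f \<and> (\<exists>K k. \<forall>x. \<bar>f x\<bar> \<le> K * exp (k * \<bar>x\<bar>))"

lemma exp_boundedE:
  assumes "exp_bounded f"
  obtains K k where "K \<ge> 0" "\<And>x. \<bar>f x\<bar> \<le> K * exp (k * \<bar>x\<bar>)"
proof -
  obtain K k where *: "\<And>x. \<bar>f x\<bar> \<le> K * exp (k * \<bar>x\<bar>)"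
    using assms by (auto simp: exp_bounded_def)
  have "0 \<le> K" using *[of 0] by simp
  with * show ?thesis by (rule that[rotated])
qed

lemma exp_bounded_cont: "exp_bounded f \<Longrightarrow> continuous_on UNIV f"
  by (simp add: exp_bounded_def)

lemma exp_bounded_bounded:
  assumes "continuous_on UNIV f" "\<And>x. \<bar>f x\<bar> \<le> K"
  shows "exp_bounded f"
  unfolding exp_bounded_def using assms
  by (intro conjI exI[of _ K] exI[of _ 0]) auto

lemma exp_bounded_const [intro!]: "exp_bounded (\<lambda>x. c)"
  by (rule exp_bounded_bounded[where K = "\<bar>c\<bar>"]) auto

lemma exp_bounded_cos [intro!]: "exp_bounded (\<lambda>x. cos (a * x))"
  by (rule exp_bounded_bounded[where K = 1]) (auto intro!: continuous_intros)

lemma exp_bounded_sin [intro!]: "exp_bounded (\<lambda>x. sin (a * x))"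
  by (rule exp_bounded_bounded[where K = 1]) (auto intro!: continuous_intros)

lemma exp_bounded_id [intro!]: "exp_bounded (\<lambda>x. x)"
proof -
  have "\<bar>x\<bar> \<le> exp \<bar>x\<bar>" for x :: real
    using exp_ge_add_one_self[of "\<bar>x\<bar>"] by linarith
  then have "\<bar>x\<bar> \<le> 1 * exp (1 * \<bar>x\<bar>)" for x :: real by simp
  then have "\<exists>K k. \<forall>x::real. \<bar>x\<bar> \<le> K * exp (k * \<bar>x\<bar>)" by blast
  then show ?thesis unfolding exp_bounded_def by simp
qed

lemma exp_bounded_add [intro!]:
  assumes "exp_bounded f" "exp_bounded g"
  shows "exp_bounded (\<lambda>x. f x + g x)"
proof -
  from assms obtain K k L l where *: "K \<ge> 0" "\<And>x. \<bar>f x\<bar> \<le> K * exp (k * \<bar>x\<bar>)"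
    "L \<ge> 0" "\<And>x. \<bar>g x\<bar> \<le> L * exp (l * \<bar>x\<bar>)" by (metis exp_boundedE)
  have "\<bar>f x + g x\<bar> \<le> (K + L) * exp (max k l * \<bar>x\<bar>)" for x
  proof -
    have "K * exp (k * \<bar>x\<bar>) \<le> K * exp (max k l * \<bar>x\<bar>)" "L * exp (l * \<bar>x\<bar>) \<le> L * exp (max k l * \<bar>x\<bar>)"
      using *(1,3) by (auto intro!: mult_left_mono mult_right_mono)
    then show ?thesis using *(2,4)[of x] by (simp add: distrib_right) linarith
  qed
  moreover have "continuous_on UNIV (\<lambda>x. f x + g x)"
    using assms by (auto intro!: continuous_intros dest: exp_bounded_cont)
  ultimately show ?thesis unfolding exp_bounded_def by blast
qed

lemma exp_bounded_mult [intro!]: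
  assumes "exp_bounded f" "exp_bounded g"
  shows "exp_bounded (\<lambda>x. f x * g x)"
proof -
  from assms obtain K k L l where *: "K \<ge> 0" "\<And>x. \<bar>f x\<bar> \<le> K * exp (k * \<bar>x\<bar>)"
    "L \<ge> 0" "\<And>x. \<bar>g x\<bar> \<le> L * exp (l * \<bar>x\<bar>)" by (metis exp_boundedE)
  have "\<bar>f x * g x\<bar> \<le> (K * L) * exp ((k + l) * \<bar>x\<bar>)" for x
  proof -
    have "\<bar>f x\<bar> * \<bar>g x\<bar> \<le> (K * exp (k * \<bar>x\<bar>)) * (L * exp (l * \<bar>x\<bar>))"
      using * by (intro mult_mono) auto
    then show ?thesis by (simp add: abs_mult distrib_right exp_add mult.assoc mult.left_commute)
  qed
  moreover have "continuous_on UNIV (\<lambda>x. f x * g x)"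
    using assms by (auto intro!: continuous_intros dest: exp_bounded_cont)
  ultimately show ?thesis unfolding exp_bounded_def by blast
qed

lemma exp_bounded_uminus [intro!]: "exp_bounded f \<Longrightarrow> exp_bounded (\<lambda>x. - f x)"
  using exp_bounded_mult[OF exp_bounded_const[of "- 1"], of f] by simp

lemma exp_bounded_diff [intro!]:
  "exp_bounded f \<Longrightarrow> exp_bounded g \<Longrightarrow> exp_bounded (\<lambda>x. f x - g x)"
  using exp_bounded_add[OF _ exp_bounded_uminus, of f g] by simp

lemma exp_bounded_power [intro!]: "exp_bounded f \<Longrightarrow> exp_bounded (\<lambda>x. f x ^ n)"
  by (induction n) auto

lemma exp_bounded_sum [intro!]:
  "(\<And>i. i \<in> A \<Longrightarrow> exp_bounded (f i)) \<Longrightarrow> exp_bounded (\<lambda>x. \<Sum>i\<in>A. f i x)"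
  by (induction A rule: infinite_finite_induct) auto

lemma exp_bounded_poly [intro!]: "exp_bounded (\<lambda>x. poly p x)"
  by (induction p) auto

section \<open>Integrability against the weight \<open>exp (- x\<^sup>2)\<close> and linearity of
  the integral\<close>

lemma has_bochner_integral_gauss: 
  "has_bochner_integral lborel (\<lambda>x::real. exp (- x\<^sup>2)) (sqrt pi)"
  using has_bochner_integral_even_function[OF gaussian_moment_0] by simp

text \<open>Completing the square makes the integrand \<open>exp (k\<^sup>2 / 4)\<close> times a
  Gaussian translated by \<open>k / 2\<close>.\<close>

lemma integrable_gauss_shift: "integrable lborel (\<lambda>x::real. exp (- x\<^sup>2 + k * x))"
proof -
  have "integrable lborel (\<lambda>x::real. exp (- (x)\<^sup>2))"
    using has_bochner_integral_gauss by (simp add: has_bochner_integral_iff)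
  then have "integrable lborel (\<lambda>x::real. exp (- (- k / 2 + 1 * x)\<^sup>2))"
    by (rule lborel_integrable_real_affine) simp
  then have "integrable lborel (\<lambda>x::real. exp (k\<^sup>2 / 4) * exp (- (- k / 2 + 1 * x)\<^sup>2))"
    by (rule integrable_mult_right)
  also have "(\<lambda>x. exp (k\<^sup>2 / 4) * exp (- (- k / 2 + 1 * x)\<^sup>2)) = (\<lambda>x::real. exp (- x\<^sup>2 + k * x))"
    by (rule ext) (simp add: exp_add[symmetric] power2_eq_square algebra_simps)
  finally show ?thesis .
qed

lemma exp_bounded_integrable:
  assumes "exp_bounded f"
  shows "integrable lborel (\<lambda>x. exp (- x\<^sup>2) * f x)"
proof -
  obtain K k where *: "K \<ge> 0" "\<And>x. \<bar>f x\<bar> \<le> K * exp (k * \<bar>x\<bar>)" using exp_boundedE[OF assms] by blast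
  have [measurable]: "f \<in> borel_measurable borel"
    using exp_bounded_cont[OF assms] by (rule borel_measurable_continuous_onI)
  show ?thesis
  proof (rule Bochner_Integration.integrable_bound)
    \<comment> \<open>\<open>exp (k * \<bar>x\<bar>)\<close> equals one of
      \<open>exp (k * x)\<close> and \<open>exp (- k * x)\<close>, so their sum dominates it without
      an absolute value in the exponent.\<close>
    show "integrable lborel (\<lambda>x. K * (exp (- x\<^sup>2 + k * x) + exp (- x\<^sup>2 + (- k) * x)))"
      by (intro integrable_mult_right Bochner_Integration.integrable_add integrable_gauss_shift)
    show "AE x in lborel. norm (exp (- x\<^sup>2) * f x)
        \<le> norm (K * (exp (- x\<^sup>2 + k * x) + exp (- x\<^sup>2 + (- k) * x)))"
    proof (rule AE_I2)
      fix x :: real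
      have "exp (- x\<^sup>2) * \<bar>f x\<bar> \<le> exp (- x\<^sup>2) * (K * exp (k * \<bar>x\<bar>))" using * by (intro mult_left_mono) auto
      also have "\<dots> = K * exp (- x\<^sup>2 + k * \<bar>x\<bar>)" by (simp only: exp_add mult.left_commute)
      also have "\<dots> \<le> K * (exp (- x\<^sup>2 + k * x) + exp (- x\<^sup>2 + (- k) * x))"
        using *(1) by (intro mult_left_mono) (auto simp: abs_if add_increasing add_increasing2)
      finally show "norm (exp (- x\<^sup>2) * f x)
        \<le> norm (K * (exp (- x\<^sup>2 + k * x) + exp (- x\<^sup>2 + (- k) * x)))"
        using *(1) by (simp add: abs_mult)
    qed
  qed simp
qed

lemma gauss_int_add:
  "exp_bounded f \<Longrightarrow> exp_bounded g \<Longrightarrow> gauss_int (\<lambda>x. f x + g x) = gauss_int f + gauss_int g"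
  unfolding gauss_int_def by (simp add: distrib_left exp_bounded_integrable)

lemma gauss_int_cmult: "gauss_int (\<lambda>x. c * f x) = c * gauss_int f"
proof -
  have "gauss_int (\<lambda>x. c * f x) = (LINT x|lborel. c * (exp (- x\<^sup>2) * f x))"
    unfolding gauss_int_def by (simp add: mult.left_commute)
  then show ?thesis unfolding gauss_int_def by simp
qed

lemma gauss_int_diff:
  "exp_bounded f \<Longrightarrow> exp_bounded g \<Longrightarrow> gauss_int (\<lambda>x. f x - g x) = gauss_int f - gauss_int g"
  unfolding gauss_int_def by (simp add: right_diff_distrib exp_bounded_integrable)

lemma gauss_int_sum:
  "(\<And>i. i \<in> A \<Longrightarrow> exp_bounded (f i)) \<Longrightarrow> gauss_int (\<lambda>x. \<Sum>i\<in>A. f i x) = (\<Sum>i\<in>A. gauss_int (f i))"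
  unfolding gauss_int_def by (simp add: sum_distrib_left exp_bounded_integrable)

lemma gauss_int_mono:
  assumes "exp_bounded f" "exp_bounded g" "\<And>x. f x \<le> g x"
  shows "gauss_int f \<le> gauss_int g"
  unfolding gauss_int_def
  by (intro integral_mono exp_bounded_integrable assms mult_left_mono) auto

lemma gauss_int_nonneg: "(\<And>x. 0 \<le> f x) \<Longrightarrow> 0 \<le> gauss_int f"
  unfolding gauss_int_def by (intro integral_nonneg_AE) auto

lemma gauss_int_one: "gauss_int (\<lambda>x. 1) = sqrt pi"
  unfolding gauss_int_def using has_bochner_integral_gauss by (simp add: has_bochner_integral_iff)

section \<open>Integration by parts and integrals of trigonometric functions\<close>

lemma exp_bounded_gauss_tendsto:
  assumes "exp_bounded f"
  shows "((\<lambda>x. exp (- x\<^sup>2) * f x) \<longlongrightarrow> 0) at_top" "((\<lambda>x. exp (- x\<^sup>2) * f x) \<longlongrightarrow> 0) at_bot"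
proof -
  obtain K k where *: "K \<ge> 0" "\<And>x. \<bar>f x\<bar> \<le> K * exp (k * \<bar>x\<bar>)" using exp_boundedE[OF assms] by blast
  have bd: "\<bar>exp (- x\<^sup>2) * f x\<bar> \<le> K * exp (- x\<^sup>2 + k * \<bar>x\<bar>)" for x
  proof -
    have "exp (- x\<^sup>2) * \<bar>f x\<bar> \<le> exp (- x\<^sup>2) * (K * exp (k * \<bar>x\<bar>))" using * by (intro mult_left_mono) auto
    then show ?thesis by (simp only: abs_mult abs_exp_cancel exp_add mult.left_commute)
  qed
  have "((\<lambda>x. K * exp (- x\<^sup>2 + k * x)) \<longlongrightarrow> 0) at_top" 
    by (rule tendsto_mult_right_zero) real_asymp
  then have 1: "((\<lambda>x. K * exp (- x\<^sup>2 + k * \<bar>x\<bar>)) \<longlongrightarrow> 0) at_top"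
    by (rule Lim_transform_eventually) (use eventually_ge_at_top[of "0::real"] in eventually_elim, simp)
  have "((\<lambda>x. K * exp (- x\<^sup>2 + k * (- x))) \<longlongrightarrow> 0) at_bot" 
    by (rule tendsto_mult_right_zero) real_asymp
  then have 2: "((\<lambda>x. K * exp (- x\<^sup>2 + k * \<bar>x\<bar>)) \<longlongrightarrow> 0) at_bot"
    by (rule Lim_transform_eventually) (use eventually_le_at_bot[of "0::real"] in eventually_elim, simp)
  show "((\<lambda>x. exp (- x\<^sup>2) * f x) \<longlongrightarrow> 0) at_top"
    by (rule Lim_null_comparison[OF _ 1]) (use bd in auto)
  show "((\<lambda>x. exp (- x\<^sup>2) * f x) \<longlongrightarrow> 0) at_bot"
    by (rule Lim_null_comparison[OF _ 2]) (use bd in auto)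
qed

text \<open>\<open>exp (- x\<^sup>2) * f x\<close> has the derivative
  \<open>exp (- x\<^sup>2) * (f' x - 2 * x * f x)\<close> and vanishes at both infinities, since
  \<open>f\<close> grows at most exponentially.\<close>

lemma gauss_int_by_parts:
  assumes "exp_bounded f" "exp_bounded f'" "\<And>x. (f has_real_derivative f' x) (at x)"
  shows "gauss_int (\<lambda>x. 2 * x * f x) = gauss_int f'"
proof -
  let ?g = "\<lambda>x. exp (- x\<^sup>2) * (f' x - 2 * x * f x)"
  have eb: "exp_bounded (\<lambda>x. 2 * x * f x)" using assms by auto
  have "(LBINT x=-\<infinity>..\<infinity>. ?g x) = 0 - 0"
  proof (rule interval_integral_FTC_integrable[where F = "\<lambda>x. exp (- x\<^sup>2) * f x"])
    show "((\<lambda>x. exp (- x\<^sup>2) * f x) has_vector_derivative ?g x) (at x)" for x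
      unfolding has_real_derivative_iff_has_vector_derivative[symmetric]
      by (auto intro!: derivative_eq_intros assms(3) simp: algebra_simps)
    have "continuous_on UNIV ?g" using assms(1,2)
      by (intro continuous_intros) (auto dest: exp_bounded_cont)
    then show "isCont ?g x" for x by (simp add: continuous_on_eq_continuous_at)
    show "set_integrable lborel (einterval (- \<infinity>) \<infinity>) ?g"
      unfolding set_integrable_def using assms eb
      by (simp add: exp_bounded_integrable exp_bounded_diff)
    show "(((\<lambda>x. exp (- x\<^sup>2) * f x) \<circ> real_of_ereal) \<longlongrightarrow> 0) (at_right (- \<infinity>))"
      "(((\<lambda>x. exp (- x\<^sup>2) * f x) \<circ> real_of_ereal) \<longlongrightarrow> 0) (at_left \<infinity>)"
      using exp_bounded_gauss_tendsto[OF assms(1)]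
      by (simp_all only: ereal_tendsto_simps)
  qed simp
  then have "gauss_int (\<lambda>x. f' x - 2 * x * f x) = 0"
    by (simp add: gauss_int_def interval_lebesgue_integral_def set_lebesgue_integral_def)
  then show ?thesis using gauss_int_diff[OF assms(2) eb] by simp
qed

text \<open>This is the characteristic function of the standard normal law at
  \<open>a / sqrt 2\<close>; substituting \<open>sqrt 2 * x\<close> for \<open>x\<close> turns its
  density into the weight.\<close>

lemma gauss_int_cos: "gauss_int (\<lambda>x. cos (a * x)) = sqrt pi * exp (- (a\<^sup>2 / 4))"
proof -
  interpret N: real_distribution std_normal_distribution by (rule real_dist_normal_dist)
  let ?t = "a / sqrt 2"
  have "Re (char std_normal_distribution ?t) = (LINT x|std_normal_distribution. cos (?t * x))"
    unfolding char_def
    by (subst integral_Re[symmetric]) (rule N.integrable_iexp, simp, simp, simp add: Re_exp)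
  also have "Re (char std_normal_distribution ?t) = exp (- (a\<^sup>2 / 4))"
    by (simp add: char_std_normal_distribution power_divide Re_exp)
  also have "(LINT x|std_normal_distribution. cos (?t * x))
      = (LINT x|lborel. std_normal_density x * cos (?t * x))"
    by (subst integral_density) auto
  also have "\<dots> = sqrt 2 * (LINT x|lborel. std_normal_density (0 + sqrt 2 * x) * cos (?t * (0 + sqrt 2 * x)))"
    by (subst lborel_integral_real_affine[where c = "sqrt 2" and t = 0]) auto
  also have "\<dots> = (LINT x|lborel. sqrt 2 * (std_normal_density (sqrt 2 * x) * cos (?t * (sqrt 2 * x))))"
    by simp
  also have "(\<lambda>x. sqrt 2 * (std_normal_density (sqrt 2 * x) * cos (?t * (sqrt 2 * x))))
      = (\<lambda>x. (1 / sqrt pi) * (exp (- x\<^sup>2) * cos (a * x)))"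
    by (rule ext) (simp add: std_normal_density_def real_sqrt_mult power_mult_distrib)
  finally show ?thesis by (simp add: gauss_int_def field_simps)
qed

lemma gauss_int_x_sin: "gauss_int (\<lambda>x. x * sin (a * x)) = a / 2 * sqrt pi * exp (- (a\<^sup>2 / 4))"
proof -
  have "gauss_int (\<lambda>x. 2 * x * sin (a * x)) = gauss_int (\<lambda>x. a * cos (a * x))"
    by (rule gauss_int_by_parts) (auto intro!: derivative_eq_intros)
  then show ?thesis
    using gauss_int_cmult[of 2 "\<lambda>x. x * sin (a * x)"] by (simp add: gauss_int_cmult gauss_int_cos mult.assoc)
qed

lemma gauss_int_x2_cos:
  "gauss_int (\<lambda>x. x\<^sup>2 * cos (a * x)) = (1 / 2 - a\<^sup>2 / 4) * sqrt pi * exp (- (a\<^sup>2 / 4))"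
proof -
  have "gauss_int (\<lambda>x. 2 * x * (x * cos (a * x))) = gauss_int (\<lambda>x. cos (a * x) - a * (x * sin (a * x)))"
    by (rule gauss_int_by_parts) (auto intro!: derivative_eq_intros)
  also have "\<dots> = gauss_int (\<lambda>x. cos (a * x)) - a * gauss_int (\<lambda>x. x * sin (a * x))"
    by (subst gauss_int_diff) (auto simp: gauss_int_cmult)
  finally show ?thesis
    using gauss_int_cmult[of 2 "\<lambda>x. x\<^sup>2 * cos (a * x)"]
    by (simp add: gauss_int_cos gauss_int_x_sin mult.assoc power2_eq_square) (simp add: algebra_simps)
qed

section \<open>Hermite polynomials\<close>

text \<open>The operator \<open>2 * x * H - H'\<close> of the recursion is adjoint to
  differentiation for the Gaussian weight: integrate \<open>H * p\<close> by parts and cancel the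
  term \<open>H' * p\<close>.\<close>

lemma gauss_int_hermite_Suc:
  "gauss_int (\<lambda>x. poly (hermite_poly (Suc k)) x * poly p x)
    = gauss_int (\<lambda>x. poly (hermite_poly k) x * poly (pderiv p) x)"
proof -
  let ?H = "hermite_poly k"
  have "gauss_int (\<lambda>x. 2 * x * poly (?H * p) x) = gauss_int (\<lambda>x. poly (pderiv (?H * p)) x)"
    by (rule gauss_int_by_parts[OF _ _ poly_DERIV]) auto
  moreover have "gauss_int (\<lambda>x. 2 * x * poly (?H * p) x) - gauss_int (\<lambda>x. poly (pderiv ?H * p) x)
      = gauss_int (\<lambda>x. poly (hermite_poly (Suc k)) x * poly p x)"
    by (subst gauss_int_diff[symmetric]) (auto simp: algebra_simps)
  moreover have "gauss_int (\<lambda>x. poly (pderiv (?H * p)) x) - gauss_int (\<lambda>x. poly (pderiv ?H * p) x)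
      = gauss_int (\<lambda>x. poly (hermite_poly k) x * poly (pderiv p) x)"
    by (subst gauss_int_diff[symmetric]) (auto simp: pderiv_mult algebra_simps)
  ultimately show ?thesis by simp
qed

text \<open>For \<open>p\<close> of degree below \<open>k\<close> the right-hand side vanishes,
  which is the orthogonality of the Hermite polynomials.\<close>

lemma gauss_int_hermite:
  "gauss_int (\<lambda>x. poly (hermite_poly k) x * poly p x) = gauss_int (\<lambda>x. poly ((pderiv ^^ k) p) x)"
proof (induction k arbitrary: p)
  case (Suc k)
  then show ?case by (simp add: gauss_int_hermite_Suc funpow_swap1 del: hermite_poly.simps(2))
qed simp

text \<open>The three leading coefficients determine those of the squares, and only these survive
  \<open>2 * m\<close> differentiations of a square of degree \<open>2 * m + 2\<close>.\<close>

lemma coeff_hermite_poly: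
  shows "n > k \<Longrightarrow> coeff (hermite_poly k) n = 0"
    and "coeff (hermite_poly k) k = 2 ^ k"
    and "n + 1 = k \<Longrightarrow> coeff (hermite_poly k) n = 0"
    and "n + 2 = k \<Longrightarrow> coeff (hermite_poly k) n = - (2 ^ k * real k * (real k - 1) / 4)"
proof -
  have step: "coeff (hermite_poly (Suc k)) n = 2 * (case n of 0 \<Rightarrow> 0 | Suc j \<Rightarrow> coeff (hermite_poly k) j)
      - real (Suc n) * coeff (hermite_poly k) (Suc n)" for k n
    by (simp add: coeff_pderiv coeff_pCons split: nat.split)
  \<comment> \<open>A joint induction is needed: the coefficient two below the top for
    \<open>Suc k\<close> involves the leading one for \<open>k\<close>.\<close>
  have *: "(\<forall>n>k. coeff (hermite_poly k) n = 0) \<and> coeff (hermite_poly k) k = 2 ^ k \<and>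
     (\<forall>n. n + 1 = k \<longrightarrow> coeff (hermite_poly k) n = 0) \<and>
     (\<forall>n. n + 2 = k \<longrightarrow> coeff (hermite_poly k) n = - (2 ^ k * real k * (real k - 1) / 4))" for k
  proof (induction k)
    case (Suc k)
    then show ?case unfolding step
      by (auto split: nat.split simp: field_simps)
  qed (auto simp: coeff_1)
  show "n > k \<Longrightarrow> coeff (hermite_poly k) n = 0"
    "coeff (hermite_poly k) k = 2 ^ k"
    "n + 1 = k \<Longrightarrow> coeff (hermite_poly k) n = 0"
    "n + 2 = k \<Longrightarrow> coeff (hermite_poly k) n = - (2 ^ k * real k * (real k - 1) / 4)"
    using *[of k] by auto
qed

lemma degree_hermite_poly: "degree (hermite_poly k) = k"
  by (intro antisym degree_le le_degree) (auto simp: coeff_hermite_poly(1,2))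

lemma higher_pderiv_degree_le_const:
  fixes p :: "real poly"
  assumes "degree p \<le> n"
  shows "(pderiv ^^ n) p = [:fact n * coeff p n:]"
proof (rule poly_eqI)
  fix i
  show "coeff ((pderiv ^^ n) p) i = coeff [:fact n * coeff p n:] i"
    using assms by (cases i) (auto simp: coeff_higher_pderiv pochhammer_fact coeff_eq_0)
qed

lemma gauss_int_hermite_square:
  "gauss_int (\<lambda>x. (poly (hermite_poly k) x)\<^sup>2) = sqrt pi * 2 ^ k * fact k"
proof -
  have "gauss_int (\<lambda>x. (poly (hermite_poly k) x)\<^sup>2) = gauss_int (\<lambda>x. fact k * 2 ^ k * 1)"
    using gauss_int_hermite[of k "hermite_poly k"]
    by (simp add: power2_eq_square higher_pderiv_degree_le_const degree_hermite_poly coeff_hermite_poly(2))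
  also have "\<dots> = fact k * 2 ^ k * sqrt pi" by (simp only: gauss_int_cmult gauss_int_one)
  finally show ?thesis by simp
qed

section \<open>Error of Gauss--Hermite quadrature\<close>

text \<open>\<open>F k\<close> is the derivative of order \<open>k\<close> of \<open>F 0\<close>;
  carrying the whole sequence keeps the derivative of order \<open>2 * m\<close> explicit.\<close>

definition deriv_tower :: "(nat \<Rightarrow> real \<Rightarrow> real) \<Rightarrow> bool" where
  "deriv_tower F \<longleftrightarrow> (\<forall>k x. (F k has_real_derivative F (Suc k) x) (at x))"

lemma deriv_towerD: "deriv_tower F \<Longrightarrow> (F k has_real_derivative F (Suc k) x) (at x)"
  by (simp add: deriv_tower_def)

lemma deriv_tower_poly: "deriv_tower (\<lambda>k. poly ((pderiv ^^ k) p))"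
  by (simp add: deriv_tower_def poly_DERIV)

lemma deriv_tower_add: "deriv_tower F \<Longrightarrow> deriv_tower G \<Longrightarrow> deriv_tower (\<lambda>k x. F k x + G k x)"
  by (auto simp: deriv_tower_def intro!: derivative_intros)

lemma deriv_tower_diff: "deriv_tower F \<Longrightarrow> deriv_tower G \<Longrightarrow> deriv_tower (\<lambda>k x. F k x - G k x)"
  by (auto simp: deriv_tower_def intro!: derivative_intros)

section \<open>Zeros of higher derivatives\<close>

text \<open>Rolle's theorem between consecutive zeros. The new zeros must avoid \<open>Z\<close>
  because they are later counted together with the nodes; the bound by \<open>Max Z\<close> keeps
  them apart from the zero found in the next induction step.\<close>

lemma Rolle_finite_zeros:
  fixes g g' :: "real \<Rightarrow> real"
  assumes "\<And>x. (g has_real_derivative g' x) (at x)"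
    and "finite Z" "Z \<noteq> {}" "\<And>z. z \<in> Z \<Longrightarrow> g z = 0"
  shows "\<exists>Z'. finite Z' \<and> Suc (card Z') = card Z \<and> Z' \<inter> Z = {} \<and> (\<forall>z\<in>Z'. g' z = 0 \<and> z < Max Z)"
  using assms(2-)
proof (induction Z rule: finite_linorder_max_induct)
  case (insert b A)
  show ?case
  proof (cases "A = {}")
    case True
    then show ?thesis by (intro exI[of _ "{}"]) auto
  next
    case False
    then obtain Z' where Z': "finite Z'" "Suc (card Z') = card A" "Z' \<inter> A = {}"
      "\<forall>z\<in>Z'. g' z = 0 \<and> z < Max A"
      using insert by auto
    have Max: "Max A \<in> A" using insert.hyps False by simp
    have "\<exists>z. Max A < z \<and> z < b \<and> (\<lambda>y. g' z * y) = (\<lambda>v. 0)"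
    proof (rule Rolle_deriv)
      show "Max A < b" "g (Max A) = g b" using Max insert by auto
      show "continuous_on {Max A..b} g"
        using assms(1) by (intro DERIV_continuous_on) (auto intro: has_field_derivative_at_within)
      show "(g has_derivative (\<lambda>y. g' x * y)) (at x)" for x
        using assms(1) by (simp add: has_field_derivative_def)
    qed
    then obtain z where z: "Max A < z" "z < b" "g' z = 0" by (metis mult.right_neutral)
    have zA: "z \<notin> A" using z Max_ge[OF insert.hyps(1), of z] by auto
    have zZ: "z \<notin> Z'" using z Z'(4) by auto
    have less: "w < b" if "w \<in> Z'" for w using that Z'(4) Max insert.hyps(2) by force
    have b: "b \<notin> A" using insert.hyps(2) by blast
    have "Max (insert b A) = b"
      using insert.hyps by (intro Max_eqI) (auto intro: less_imp_le)
    moreover have "insert z Z' \<inter> insert b A = {}" using zA z(2) Z'(3) less by auto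
    moreover have "Suc (card (insert z Z')) = card (insert b A)" using zZ b Z'(1,2) insert.hyps(1) by simp
    ultimately show ?thesis using Z' z less by (intro exI[of _ "insert z Z'"]) simp
  qed
qed simp

lemma higher_Rolle:
  fixes F :: "nat \<Rightarrow> real \<Rightarrow> real"
  assumes "\<And>k x. (F k has_real_derivative F (Suc k) x) (at x)"
    and "finite Z" "card Z > n" "\<And>z. z \<in> Z \<Longrightarrow> F 0 z = 0"
  shows "\<exists>x. F n x = 0"
  using assms
proof (induction n arbitrary: F Z)
  case 0
  then have "Z \<noteq> {}" by auto
  then show ?case using 0 by blast
next
  case (Suc n)
  have "Z \<noteq> {}" using Suc.prems by auto
  then obtain Z' where "finite Z'" "Suc (card Z') = card Z" "\<forall>z\<in>Z'. F (Suc 0) z = 0"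
    using Rolle_finite_zeros[of "F 0" "F (Suc 0)" Z] Suc.prems by metis
  then show ?case using Suc.IH[of "\<lambda>k. F (Suc k)" Z'] Suc.prems by auto
qed

section \<open>Hermite interpolation\<close>

definition nodal_poly :: "real set \<Rightarrow> real poly" where
  "nodal_poly S = (\<Prod>x\<in>S. [:- x, 1:])"

lemma poly_nodal_poly_eq_0_iff: "finite S \<Longrightarrow> poly (nodal_poly S) x = 0 \<longleftrightarrow> x \<in> S"
  by (auto simp: nodal_poly_def poly_prod)

lemma degree_nodal_poly: "degree (nodal_poly S) = card S"
  unfolding nodal_poly_def by (subst degree_prod_sum_eq) auto

lemma monic_nodal_poly: "coeff (nodal_poly S) (card S) = 1"
  using degree_nodal_poly[of S] lead_coeff_prod[of "\<lambda>x. [:- x, 1:]" S] by (simp add: nodal_poly_def)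

text \<open>The factor \<open>[:- x, 1:]\<close> occurs only once. This permits division by the
  derivative when slopes are prescribed at the nodes.\<close>

lemma poly_pderiv_nodal_poly:
  assumes "finite S" "x \<in> S"
  shows "poly (pderiv (nodal_poly S)) x \<noteq> 0"
proof -
  have "nodal_poly S = [:- x, 1:] * nodal_poly (S - {x})"
    unfolding nodal_poly_def using assms by (rule prod.remove)
  then have "poly (pderiv (nodal_poly S)) x = poly (nodal_poly (S - {x})) x"
    by (simp only: pderiv_mult) (simp add: pderiv_pCons)
  then show ?thesis using assms by (simp add: poly_nodal_poly_eq_0_iff)
qed

text \<open>Newton's form: a multiple of the nodal polynomial of the old nodes corrects the value at
  the new node and leaves the old values alone.\<close>

lemma lagrange_interpolant_exists:
  fixes v :: "real \<Rightarrow> real"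
  assumes "finite S"
  shows "\<exists>p. degree p \<le> card S - 1 \<and> (\<forall>x\<in>S. poly p x = v x)"
  using assms
proof (induction S)
  case (insert a S)
  then obtain p where p: "degree p \<le> card S - 1" "\<forall>x\<in>S. poly p x = v x" by blast
  let ?q = "p + smult ((v a - poly p a) / poly (nodal_poly S) a) (nodal_poly S)"
  have "degree ?q \<le> card S"
    using p by (intro degree_add_le) (auto simp: degree_nodal_poly)
  moreover have "\<forall>x\<in>insert a S. poly ?q x = v x"
    using insert p by (auto simp: poly_nodal_poly_eq_0_iff field_simps)
  ultimately show ?case using insert by (intro exI[of _ ?q]) auto
qed (auto intro: exI[of _ 0])

text \<open>With \<open>h\<close> the nodal polynomial, the summand \<open>h * r\<close> vanishes at
  the nodes and has slope \<open>h' * r\<close> there, so \<open>r\<close> interpolates the missing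
  slopes divided by \<open>h'\<close>.\<close>

lemma hermite_interpolant_exists:
  fixes v v' :: "real \<Rightarrow> real"
  assumes "finite S" "S \<noteq> {}"
  obtains p where "degree p \<le> 2 * card S - 1" "\<And>x. x \<in> S \<Longrightarrow> poly p x = v x"
    "\<And>x. x \<in> S \<Longrightarrow> poly (pderiv p) x = v' x"
proof -
  let ?h = "nodal_poly S"
  have pos: "card S > 0" using assms by (simp add: card_gt_0_iff)
  obtain p where p: "degree p \<le> card S - 1" "\<forall>x\<in>S. poly p x = v x"
    using lagrange_interpolant_exists assms by blast
  obtain r where r: "degree r \<le> card S - 1"
    "\<forall>x\<in>S. poly r x = (v' x - poly (pderiv p) x) / poly (pderiv ?h) x"
    using lagrange_interpolant_exists[OF assms(1),
        of "\<lambda>x. (v' x - poly (pderiv p) x) / poly (pderiv ?h) x"] by blast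
  show ?thesis
  proof (rule that[of "p + ?h * r"])
    have "degree (?h * r) \<le> card S + (card S - 1)"
      using degree_mult_le[of ?h r] r(1) by (simp add: degree_nodal_poly)
    then show "degree (p + ?h * r) \<le> 2 * card S - 1"
      using p(1) pos by (intro degree_add_le) auto
    show "poly (p + ?h * r) x = v x" "poly (pderiv (p + ?h * r)) x = v' x" if "x \<in> S" for x
      using that p r assms(1) poly_pderiv_nodal_poly[OF assms(1) that]
      by (simp_all add: pderiv_add pderiv_mult poly_nodal_poly_eq_0_iff)
  qed
qed

text \<open>The interpolation error is \<open>F (2 * card S) \<xi> / fact (2 * card S)\<close> times
  the square of the nodal polynomial, so it inherits the sign of that derivative.\<close>

lemma hermite_interpolant_le:
  assumes F: "deriv_tower F" and S: "finite S" "S \<noteq> {}"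
    and p: "degree p \<le> 2 * card S - 1" "\<And>x. x \<in> S \<Longrightarrow> poly p x = F 0 x"
    "\<And>x. x \<in> S \<Longrightarrow> poly (pderiv p) x = F 1 x"
    and nonneg: "\<And>x. F (2 * card S) x \<ge> 0"
  shows "poly p x \<le> F 0 x"
proof (cases "x \<in> S")
  case False
  let ?h = "nodal_poly S" and ?m = "card S"
  have pos: "?m > 0" using S by (simp add: card_gt_0_iff)
  have hx: "poly ?h x \<noteq> 0" using False S by (simp add: poly_nodal_poly_eq_0_iff)
  \<comment> \<open>\<open>F 0 - p - c h\<^sup>2\<close> vanishes at \<open>x\<close> and doubly at the nodes, so its derivative of order \<open>2 card S\<close>
    has a zero.\<close>
  define c where "c = (F 0 x - poly p x) / (poly ?h x)\<^sup>2"
  define q where "q = p + smult c (?h * ?h)"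
  define G where "G = (\<lambda>k y. F k y - poly ((pderiv ^^ k) q) y)"
  have G: "deriv_tower G" unfolding G_def by (intro deriv_tower_diff F deriv_tower_poly)
  have "F 0 x = poly q x" using hx by (simp add: q_def c_def power2_eq_square)
  then have G0: "G 0 z = 0" if "z \<in> insert x S" for z
    using that p S by (auto simp: G_def q_def poly_nodal_poly_eq_0_iff)
  have G1: "G 1 z = 0" if "z \<in> S" for z
    using that p S by (simp add: G_def q_def poly_nodal_poly_eq_0_iff pderiv_add pderiv_smult pderiv_mult)
  have "\<exists>Z'. finite Z' \<and> Suc (card Z') = card (insert x S) \<and> Z' \<inter> insert x S = {} \<and>
      (\<forall>z\<in>Z'. G 1 z = 0 \<and> z < Max (insert x S))"
    using S G0 by (intro Rolle_finite_zeros[of "G 0"]) (auto intro: deriv_towerD[OF G, of 0, simplified])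
  then obtain Z' where Z': "finite Z'" "Suc (card Z') = card (insert x S)" "Z' \<inter> insert x S = {}"
      "\<forall>z\<in>Z'. G 1 z = 0" by blast
  have card: "card (S \<union> Z') = 2 * ?m"
    using Z' S False by (subst card_Un_disjoint) auto
  \<comment> \<open>The sequence starts at \<open>G 1\<close>: its \<open>2 * card S\<close> zeros,
    half of them nodes and half from Rolle, yield a zero of the derivative
    \<open>2 * card S - 1\<close> orders higher.\<close>
  have "\<exists>\<xi>. G (Suc (2 * ?m - 1)) \<xi> = 0"
    by (rule higher_Rolle[of "\<lambda>k. G (Suc k)" "S \<union> Z'"])
      (use Z' S G1 card pos in \<open>auto intro: deriv_towerD[OF G]\<close>)
  then obtain \<xi> where "G (2 * ?m) \<xi> = 0" using pos by auto
  moreover have "(pderiv ^^ (2 * ?m)) q = [:fact (2 * ?m) * c:]"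
  proof -
    have "degree (?h * ?h) \<le> 2 * ?m"
      using degree_mult_le[of ?h ?h] by (simp add: degree_nodal_poly)
    moreover have "coeff (?h * ?h) (2 * ?m) = 1"
      using coeff_mult_degree_sum[of ?h ?h] by (simp add: degree_nodal_poly monic_nodal_poly mult_2)
    moreover have "coeff p (2 * ?m) = 0" using p(1) pos by (intro coeff_eq_0) auto
    ultimately show ?thesis
      using p(1) pos unfolding q_def
      by (subst higher_pderiv_degree_le_const) (auto intro!: degree_add_le)
  qed
  ultimately have "F (2 * ?m) \<xi> = fact (2 * ?m) * c" by (simp add: G_def)
  with nonneg[of \<xi>] have "c \<ge> 0" using fact_gt_zero[of "2 * ?m", where ?'a = real] by (simp add: zero_le_mult_iff del: fact_gt_zero)
  then show ?thesis using hx by (simp add: c_def zero_le_divide_iff)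
qed (use p in simp)

section \<open>Bounds for the quadrature error\<close>

definition quad :: "real^'m \<Rightarrow> real^'m \<Rightarrow> (real \<Rightarrow> real) \<Rightarrow> real" where
  "quad \<omega> W f = (\<Sum>q\<in>UNIV. W $ q * f (\<omega> $ q))"

lemma gauss_hermite_rule_exact:
  fixes \<omega> W :: "real^'m"
  assumes "gauss_hermite_rule \<omega> W" "degree p \<le> 2 * CARD('m) - 1"
  shows "gauss_int (poly p) = quad \<omega> W (poly p)"
  using assms unfolding gauss_hermite_rule_def gauss_int_def quad_def
  by (blast intro: has_bochner_integral_integral_eq)

text \<open>The quadrature sum sees only node values, so it equals that of the Hermite interpolant,
  whose degree is within the range of exactness and which lies below \<open>F 0\<close>.\<close>

lemma quad_le_gauss_int:
  fixes \<omega> W :: "real^'m"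
  assumes rule: "gauss_hermite_rule \<omega> W" and F: "deriv_tower F" "exp_bounded (F 0)"
    and nonneg: "\<And>x. F (2 * CARD('m)) x \<ge> 0"
  shows "quad \<omega> W (F 0) \<le> gauss_int (F 0)"
proof -
  define S where "S = range (\<lambda>q. \<omega> $ q)"
  have S: "finite S" "S \<noteq> {}" by (simp_all add: S_def)
  have cardS: "card S = CARD('m)"
    using card_image[of "\<lambda>q. \<omega> $ q" UNIV] rule unfolding S_def gauss_hermite_rule_def by blast
  obtain p where p: "degree p \<le> 2 * card S - 1" "\<And>x. x \<in> S \<Longrightarrow> poly p x = F 0 x"
    "\<And>x. x \<in> S \<Longrightarrow> poly (pderiv p) x = F 1 x"
    using hermite_interpolant_exists[OF S(1,2)] by metis
  have "quad \<omega> W (F 0) = quad \<omega> W (poly p)"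
    unfolding quad_def using p(2) by (intro sum.cong) (auto simp: S_def)
  also have "\<dots> = gauss_int (poly p)"
    using gauss_hermite_rule_exact[OF rule] p(1) cardS by simp
  also have "\<dots> \<le> gauss_int (F 0)"
    using F(2) hermite_interpolant_le[OF F(1) S(1,2) p] nonneg cardS
    by (intro gauss_int_mono) auto
  finally show ?thesis .
qed

text \<open>Squares of Hermite polynomials are used because a quadrature sum of a nonnegative function is
  nonnegative: the quadrature error of such a majorant is at most its Gaussian integral, which is
  exponentially smaller in \<open>m\<close> than that of a monomial with the same derivative of order \<open>2 m\<close>.\<close>

lemma hermite_square_majorant:
  fixes m :: nat
  assumes "\<alpha> \<ge> 0"
  obtains P :: "real poly" and A B :: real where
    "\<And>x. poly ((pderiv ^^ (2 * m)) P) x = \<alpha> * (1 + x\<^sup>2)"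
    "P = smult A (hermite_poly m * hermite_poly m)
       + smult B (hermite_poly (Suc m) * hermite_poly (Suc m))"
    "A \<ge> 0" "B \<ge> 0"
    "A * 2 ^ m * fact m + B * 2 ^ Suc m * fact (Suc m) \<le> 2 * \<alpha> * fact m / (2 ^ m * fact (2 * m))"
proof -
  let ?H = "hermite_poly m * hermite_poly m" and ?K = "hermite_poly (Suc m) * hermite_poly (Suc m)"
  note [simp del] = hermite_poly.simps fact_Suc power_Suc
  \<comment> \<open>\<open>B\<close> makes the leading coefficient of the second square contribute
    \<open>\<alpha> * x\<^sup>2\<close>; \<open>A\<close> then fixes the constant term at
    \<open>\<alpha>\<close>, compensating the coefficient of degree \<open>2 * m\<close> in that
    square, which is at most 0.\<close>
  define B where "B = 2 * \<alpha> / (4 ^ Suc m * fact (2 * m + 2))"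
  define A where "A = \<alpha> * (1 + real m / (2 * (2 * real m + 1))) / (4 ^ m * fact (2 * m))"
  let ?P = "smult A ?H + smult B ?K"
  have fact2: "fact (2 * m + 2) = (2 * real m + 2) * (2 * real m + 1) * fact (2 * m)"
    by (simp add: fact_Suc add.commute)
  have four: "(4::real) ^ k = 2 ^ k * 2 ^ k" for k by (simp flip: power_mult_distrib)
  have H: "coeff ?H (2 * m) = 4 ^ m"
    using coeff_mult_degree_sum[of "hermite_poly m" "hermite_poly m"]
    by (simp add: degree_hermite_poly coeff_hermite_poly(2) four mult_2)
  have H0: "coeff ?H n = 0" if "n > 2 * m" for n
    using that degree_mult_le[of "hermite_poly m" "hermite_poly m"]
    by (intro coeff_eq_0) (simp add: degree_hermite_poly)
  have K: "coeff ?K (2 * m + 2) = 4 ^ Suc m"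
    using coeff_mult_degree_sum[of "hermite_poly (Suc m)" "hermite_poly (Suc m)"]
    by (simp add: degree_hermite_poly coeff_hermite_poly(2) four mult_2)
  have K0: "coeff ?K n = 0" if "n > 2 * m + 2" for n
    using that degree_mult_le[of "hermite_poly (Suc m)" "hermite_poly (Suc m)"]
    by (intro coeff_eq_0) (simp add: degree_hermite_poly)
  \<comment> \<open>Two indices with sum \<open>2 * m + 1\<close> either include one above
    \<open>Suc m\<close> or are \<open>m\<close> and \<open>Suc m\<close>, and the coefficient of
    degree \<open>m\<close> vanishes by parity.\<close>
  have K1: "coeff ?K (2 * m + 1) = 0"
    unfolding coeff_mult
  proof (intro sum.neutral ballI)
    fix i assume "i \<in> {..2 * m + 1}"
    then consider "i > Suc m" | "2 * m + 1 - i > Suc m" | "i = m" | "2 * m + 1 - i = m"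
      by fastforce
    then show "coeff (hermite_poly (Suc m)) i * coeff (hermite_poly (Suc m)) (2 * m + 1 - i) = 0"
      by cases (simp_all add: coeff_hermite_poly(1,3))
  qed
  have K2: "coeff ?K (2 * m) = - (4 ^ Suc m * real m * (real m + 1) / 2)"
  proof (cases m)
    case 0
    then show ?thesis by (simp add: coeff_mult coeff_hermite_poly(3))
  next
    case (Suc k)
    let ?c = "\<lambda>i. coeff (hermite_poly (Suc m)) i * coeff (hermite_poly (Suc m)) (2 * m - i)"
    have "coeff ?K (2 * m) = (\<Sum>i\<in>{k, m, Suc m}. ?c i)"
      unfolding coeff_mult
    proof (rule sum.mono_neutral_right)
      show "\<forall>i\<in>{..2 * m} - {k, m, Suc m}. ?c i = 0"
      proof
        fix i assume "i \<in> {..2 * m} - {k, m, Suc m}"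
        then consider "i > Suc m" | "2 * m - i > Suc m"
          using Suc by fastforce
        then show "?c i = 0" by cases (simp_all add: coeff_hermite_poly(1))
      qed
    qed (use Suc in auto)
    also have "\<dots> = ?c k + ?c m + ?c (Suc m)" using Suc by simp
    finally have "coeff ?K (2 * m) = ?c k + ?c m + ?c (Suc m)" .
    moreover have "2 * m - k = Suc m" "2 * m - m = m" "2 * m - Suc m = k" using Suc by auto
    ultimately show ?thesis
      using coeff_hermite_poly(4)[of k "Suc m"] Suc
      by (simp add: coeff_hermite_poly(2,3) four)
  qed
  have "(pderiv ^^ (2 * m)) ?P = [:\<alpha>, 0, \<alpha>:]"
  proof (rule poly_eqI)
    fix i :: nat
    \<comment> \<open>Differentiating \<open>x ^ (2 * m + 2)\<close> a total of \<open>2 * m\<close>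
      times leaves this product, from 3 to \<open>2 * m + 2\<close>, in front of
      \<open>x\<^sup>2\<close>.\<close>
    have poch: "pochhammer 3 (2 * m) = (fact (2 * m + 2) / 2 :: real)"
      using pochhammer_product'[of "1::real" 2 "2 * m"]
        pochhammer_fact[of "2 + 2 * m", where ?'a = real] pochhammer_fact[of 2, where ?'a = real]
      by (simp add: add.commute)
    consider "i = 0" | "i = 1" | "i = 2" | "i > 2" by linarith
    then show "coeff ((pderiv ^^ (2 * m)) ?P) i = coeff [:\<alpha>, 0, \<alpha>:] i"
    proof cases
      case 1
      have "fact (2 * m) * (A * 4 ^ m - B * (4 ^ Suc m * real m * (real m + 1) / 2)) = \<alpha>"
        unfolding A_def B_def fact2 by (simp add: divide_simps) (simp add: algebra_simps)
      then show ?thesis using 1 by (simp add: coeff_higher_pderiv pochhammer_fact[symmetric] H K2)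
    next
      case 2
      then show ?thesis using K1 H0 by (simp add: coeff_higher_pderiv)
    next
      case 3
      have "fact (2 * m + 2) \<noteq> (0::real)" by (rule fact_nonzero)
      then have "pochhammer 3 (2 * m) * (B * 4 ^ Suc m) = \<alpha>" unfolding poch B_def by simp
      moreover have "coeff ((pderiv ^^ (2 * m)) ?P) 2 = pochhammer 3 (2 * m) * (B * 4 ^ Suc m)"
        using K H0[of "2 * m + 2"] by (simp add: coeff_higher_pderiv add.commute)
      ultimately show ?thesis using 3 by (simp add: numeral_2_eq_2)
    next
      case 4
      then have "coeff [:\<alpha>, 0, \<alpha>:] i = 0" by (intro coeff_eq_0) auto
      with 4 show ?thesis using K0 H0 by (simp add: coeff_higher_pderiv)
    qed
  qed
  then have 1: "poly ((pderiv ^^ (2 * m)) ?P) x = \<alpha> * (1 + x\<^sup>2)" for x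
    by (simp add: algebra_simps power2_eq_square)
  have "A * 2 ^ m * fact m + B * 2 ^ Suc m * fact (Suc m)
      = \<alpha> * fact m / (2 ^ m * fact (2 * m)) * (1 + (real m + 1) / (2 * (2 * real m + 1)))"
    unfolding A_def B_def fact2 four by (simp add: fact_Suc divide_simps) (simp add: algebra_simps power_Suc)
  also have "\<dots> \<le> \<alpha> * fact m / (2 ^ m * fact (2 * m)) * 2"
    using assms by (intro mult_left_mono) (auto simp: divide_simps)
  finally have "A * 2 ^ m * fact m + B * 2 ^ Suc m * fact (Suc m)
      \<le> 2 * \<alpha> * fact m / (2 ^ m * fact (2 * m))" by (simp add: mult_ac)
  with 1 show ?thesis using assms by (intro that[of ?P A B]) (auto simp: A_def B_def)
qed

text \<open>Both \<open>P + F 0\<close> and \<open>P - F 0\<close> have a nonnegative derivative of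
  order \<open>2 * m\<close>, so quadrature underestimates both. The error of \<open>F 0\<close> is
  thus at most that of \<open>P\<close>, and this is at most the integral of
  \<open>P\<close>.\<close>

lemma quad_error_le:
  fixes \<omega> W :: "real^'m"
  assumes rule: "gauss_hermite_rule \<omega> W" and F: "deriv_tower F" "exp_bounded (F 0)"
    and bound: "\<And>x. \<bar>F (2 * CARD('m)) x\<bar> \<le> \<alpha> * (1 + x\<^sup>2)"
  shows "\<bar>gauss_int (F 0) - quad \<omega> W (F 0)\<bar>
    \<le> 2 * \<alpha> * sqrt pi * fact CARD('m) / (2 ^ CARD('m) * fact (2 * CARD('m)))"
proof -
  let ?m = "CARD('m)"
  have "\<alpha> \<ge> 0" using bound[of 0] by simp
  then obtain P A B where P: "\<And>x. poly ((pderiv ^^ (2 * ?m)) P) x = \<alpha> * (1 + x\<^sup>2)"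
    "P = smult A (hermite_poly ?m * hermite_poly ?m)
       + smult B (hermite_poly (Suc ?m) * hermite_poly (Suc ?m))"
    and AB: "A \<ge> 0" "B \<ge> 0"
    "A * 2 ^ ?m * fact ?m + B * 2 ^ Suc ?m * fact (Suc ?m) \<le> 2 * \<alpha> * fact ?m / (2 ^ ?m * fact (2 * ?m))"
    using hermite_square_majorant[of \<alpha> ?m] by blast
  have P': "poly P = (\<lambda>x. A * (poly (hermite_poly ?m) x)\<^sup>2 + B * (poly (hermite_poly (Suc ?m)) x)\<^sup>2)"
    unfolding P(2) by (rule ext) (simp add: power2_eq_square)
  have "gauss_int (poly P) = sqrt pi * (A * 2 ^ ?m * fact ?m + B * 2 ^ Suc ?m * fact (Suc ?m))"
    unfolding P' 
    by (subst gauss_int_add) (auto simp only: gauss_int_cmult gauss_int_hermite_square algebra_simps)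
  also have "\<dots> \<le> sqrt pi * (2 * \<alpha> * fact ?m / (2 ^ ?m * fact (2 * ?m)))"
    using AB by (intro mult_left_mono) auto
  finally have IP: "gauss_int (poly P) \<le> 2 * \<alpha> * sqrt pi * fact ?m / (2 ^ ?m * fact (2 * ?m))"
    by (simp add: algebra_simps)
  have W: "W $ q > 0" for q using rule by (simp add: gauss_hermite_rule_def)
  have QP: "quad \<omega> W (poly P) \<ge> 0"
    unfolding quad_def P' using AB by (intro sum_nonneg mult_nonneg_nonneg add_nonneg_nonneg) (auto intro: less_imp_le[OF W])
  have eP: "exp_bounded (poly P)" by (rule exp_bounded_poly)
  have bounds: "0 \<le> poly ((pderiv ^^ (2 * ?m)) P) x + F (2 * ?m) x"
    "0 \<le> poly ((pderiv ^^ (2 * ?m)) P) x - F (2 * ?m) x" for x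
    using bound[of x] unfolding P(1) by linarith+
  have "quad \<omega> W (\<lambda>x. poly P x + F 0 x) \<le> gauss_int (\<lambda>x. poly P x + F 0 x)"
    using quad_le_gauss_int[OF rule deriv_tower_add[OF deriv_tower_poly[of P] F(1)] _ bounds(1)]
      exp_bounded_add[OF eP F(2)] by simp
  moreover have "quad \<omega> W (\<lambda>x. poly P x - F 0 x) \<le> gauss_int (\<lambda>x. poly P x - F 0 x)"
    using quad_le_gauss_int[OF rule deriv_tower_diff[OF deriv_tower_poly[of P] F(1)] _ bounds(2)]
      exp_bounded_diff[OF eP F(2)] by simp
  moreover have "quad \<omega> W (\<lambda>x. poly P x + F 0 x) = quad \<omega> W (poly P) + quad \<omega> W (F 0)"
    "quad \<omega> W (\<lambda>x. poly P x - F 0 x) = quad \<omega> W (poly P) - quad \<omega> W (F 0)"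
    by (simp_all add: quad_def distrib_left right_diff_distrib sum.distrib sum_subtractf)
  moreover have "gauss_int (\<lambda>x. poly P x + F 0 x) = gauss_int (poly P) + gauss_int (F 0)"
    "gauss_int (\<lambda>x. poly P x - F 0 x) = gauss_int (poly P) - gauss_int (F 0)"
    using gauss_int_add[OF eP F(2)] gauss_int_diff[OF eP F(2)] by simp_all
  ultimately show ?thesis using IP QP by (simp add: abs_le_iff)
qed

section \<open>The risk as the value of a variational problem\<close>

text \<open>The quadratic form of the joint covariance matrix of states and derivatives. Its
  off-diagonal blocks are transposes of each other, hence the single doubled mixed term.\<close>

definition block_form :: "real^'n^'n \<Rightarrow> real^'n^'n \<Rightarrow> real^'n^'n \<Rightarrow> real^'n \<Rightarrow> real^'n \<Rightarrow> real" where
  "block_form K Ky Kxy p q = p \<bullet> (K *v p) + 2 * (p \<bullet> (Ky *v q)) + q \<bullet> (Kxy *v q)"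

lemma mat_vector_mult: "mat c *v x = c *\<^sub>R (x :: real^'n)"
  by (simp add: vec_eq_iff matrix_vector_mult_def mat_def if_distrib[of "\<lambda>a. a * _"] cong: if_cong)

lemma matrix_inv_mult_vector:
  fixes M :: "real^'n^'n"
  assumes "\<And>v. M *v v = 0 \<Longrightarrow> v = 0"
  shows "M *v (matrix_inv M *v v) = v" "matrix_inv M *v (M *v v) = v"
proof -
  have "inj ((*v) M)"
    by (rule injI) (metis assms eq_iff_diff_eq_0 matrix_vector_mult_diff_distrib)
  then have "\<exists>N. M ** N = mat 1 \<and> N ** M = mat 1"
    by (metis matrix_left_invertible_injective matrix_left_right_inverse)
  then have "M ** matrix_inv M = mat 1 \<and> matrix_inv M ** M = mat 1"
    unfolding matrix_inv_def by (rule someI_ex)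
  then show "M *v (matrix_inv M *v v) = v" "matrix_inv M *v (M *v v) = v"
    by (simp_all add: matrix_vector_mul_assoc)
qed

text \<open>The two quadratic forms of the risk together are the quadratic form of the inverse of the
  block matrix with rows \<open>(K + lam I, Ky)\<close> and \<open>(Kx, Kxy + gam I)\<close>, expressed by its
  variational characterisation.\<close>

lemma risk_form_variational:
  fixes K Kx Ky Kxy :: "real^'n^'n" and x g :: "real^'n" and lam gam :: real
  assumes sym: "transpose K = K" "transpose Ky = Kx" "transpose Kxy = Kxy"
    and psd: "\<And>p q. block_form K Ky Kxy p q \<ge> 0"
    and pos: "lam > 0" "gam > 0"
  defines "S \<equiv> x \<bullet> (matrix_inv (K + mat lam) *v x) + (g - D_mat lam K Kx *v x) \<bullet>
      (matrix_inv (A_mat lam K Kx Ky Kxy + mat gam) *v (g - D_mat lam K Kx *v x))"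
    and "M \<equiv> \<lambda>p q. block_form K Ky Kxy p q + lam * (p \<bullet> p) + gam * (q \<bullet> q)"
  shows "\<exists>p q. S = 2 * (p \<bullet> x + q \<bullet> g) - M p q"
    and "2 * (p \<bullet> x + q \<bullet> g) - M p q \<le> S"
proof -
  define Kl where "Kl = K + mat lam"
  define B where "B = A_mat lam K Kx Ky Kxy + mat gam"
  have symK: "a \<bullet> (K *v b) = b \<bullet> (K *v a)" for a b
    using sym(1) by (metis dot_lmul_matrix inner_commute vector_transpose_matrix)
  have symKxy: "a \<bullet> (Kxy *v b) = b \<bullet> (Kxy *v a)" for a b
    using sym(3) by (metis dot_lmul_matrix inner_commute vector_transpose_matrix)
  have adj: "b \<bullet> (Kx *v a) = a \<bullet> (Ky *v b)" for a b
    using sym(2) by (metis dot_lmul_matrix inner_commute transpose_matrix_vector)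
  have Kl: "Kl *v a = K *v a + lam *\<^sub>R a" for a
    by (simp add: Kl_def matrix_vector_mult_add_rdistrib mat_vector_mult)
  have M_eq: "M p q = p \<bullet> (Kl *v p) + 2 * (p \<bullet> (Ky *v q)) + q \<bullet> (Kxy *v q) + gam * (q \<bullet> q)" for p q
    by (simp add: M_def block_form_def Kl inner_add_right)
  have M_nonneg: "M p q \<ge> 0" for p q using psd[of p q] pos by (simp add: M_def)
  \<comment> \<open>Inserting \<open>q = 0\<close> shows that \<open>K\<close> is positive
    semidefinite, so \<open>Kl\<close> is positive definite.\<close>
  have Kl0: "v = 0" if "Kl *v v = 0" for v
  proof -
    have "0 = M v 0" using that by (simp add: M_eq)
    then have "lam * (v \<bullet> v) \<le> 0" using psd[of v 0] by (simp add: M_def)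
    then show ?thesis using pos by (simp add: mult_le_0_iff flip: power2_norm_eq_inner)
  qed
  note Kinv = matrix_inv_mult_vector[OF Kl0]
  have symKl: "a \<bullet> (Kl *v b) = b \<bullet> (Kl *v a)" for a b
    by (simp add: Kl inner_add_right symK[of a b] inner_commute)
  have symKi: "a \<bullet> (matrix_inv Kl *v b) = b \<bullet> (matrix_inv Kl *v a)" for a b
    using symKl[of "matrix_inv Kl *v a" "matrix_inv Kl *v b"] by (simp add: Kinv inner_commute)
  have B: "B *v q = Kxy *v q - Kx *v (matrix_inv Kl *v (Ky *v q)) + gam *\<^sub>R q" for q
    by (simp add: B_def A_mat_def Kl_def matrix_vector_mult_add_rdistrib mat_vector_mult
        matrix_vector_mult_diff_rdistrib matrix_vector_mul_assoc matrix_mul_assoc)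
  have B0: "q = 0" if "B *v q = 0" for q
  proof -
    \<comment> \<open>This point minimises \<open>M p q\<close> over \<open>p\<close>; the minimum
      is the quadratic form of \<open>B\<close>, the Schur complement of \<open>Kl\<close> in the
      regularised block matrix.\<close>
    let ?p = "- (matrix_inv Kl *v (Ky *v q))"
    have "Kl *v ?p = - (Ky *v q)" by (simp add: vec.neg Kinv)
    then have "M ?p q = ?p \<bullet> (Ky *v q) + q \<bullet> (Kxy *v q) + gam * (q \<bullet> q)"
      by (simp add: M_eq)
    also have "\<dots> = q \<bullet> (B *v q)"
      using adj[of q "matrix_inv Kl *v (Ky *v q)"] by (simp add: B inner_add_right inner_diff_right)
    finally have "M ?p q = 0" using that by simp
    moreover have "M ?p q \<ge> gam * (q \<bullet> q)" using psd[of ?p q] pos by (simp add: M_def)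
    ultimately have "gam * (q \<bullet> q) \<le> 0" by simp
    then show ?thesis using pos by (simp add: mult_le_0_iff flip: power2_norm_eq_inner)
  qed
  note Binv = matrix_inv_mult_vector[OF B0]
  define v where "v = g - D_mat lam K Kx *v x"
  \<comment> \<open>Block elimination: \<open>(p0, q0)\<close> solves the linear system with
    right-hand side \<open>(x, g)\<close> and is therefore the maximiser.\<close>
  define q0 where "q0 = matrix_inv B *v v"
  define p0 where "p0 = matrix_inv Kl *v (x - Ky *v q0)"
  have Dx: "D_mat lam K Kx *v x = Kx *v (matrix_inv Kl *v x)"
    by (simp add: D_mat_def Kl_def matrix_vector_mul_assoc)
  have eq1: "x = Kl *v p0 + Ky *v q0" by (simp add: p0_def Kinv)
  have eq2: "g = Kx *v p0 + Kxy *v q0 + gam *\<^sub>R q0"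
  proof -
    have "Kx *v p0 = D_mat lam K Kx *v x - Kx *v (matrix_inv Kl *v (Ky *v q0))"
      by (simp add: p0_def Dx matrix_vector_mult_diff_distrib)
    then have "Kx *v p0 + Kxy *v q0 + gam *\<^sub>R q0 = D_mat lam K Kx *v x + B *v q0"
      by (simp add: B algebra_simps)
    then show ?thesis by (simp add: q0_def Binv v_def)
  qed
  have "S = x \<bullet> (matrix_inv Kl *v x) + v \<bullet> q0"
    by (simp add: S_def Kl_def B_def q0_def v_def)
  moreover have "p0 \<bullet> x = x \<bullet> (matrix_inv Kl *v x) - q0 \<bullet> (D_mat lam K Kx *v x)"
    unfolding p0_def Dx adj
    by (simp add: matrix_vector_mult_diff_distrib inner_diff_left inner_diff_right inner_commute[of _ x] symKi[of x "Ky *v q0"])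
       (simp add: inner_commute)
  moreover have "q0 \<bullet> g = q0 \<bullet> v + q0 \<bullet> (D_mat lam K Kx *v x)"
    by (simp add: v_def inner_diff_right)
  ultimately have S: "S = p0 \<bullet> x + q0 \<bullet> g" by (simp add: inner_commute)
  have lin: "p \<bullet> x + q \<bullet> g = p \<bullet> (Kl *v p0) + p \<bullet> (Ky *v q0) + p0 \<bullet> (Ky *v q) + q \<bullet> (Kxy *v q0) + gam * (q \<bullet> q0)"
    for p q
    by (subst eq1, subst eq2) (simp add: inner_add_right adj)
  have SM: "S = M p0 q0" unfolding S lin M_eq by simp
  show "\<exists>p q. S = 2 * (p \<bullet> x + q \<bullet> g) - M p q"
    using S SM by (intro exI[of _ p0] exI[of _ q0]) simp
  \<comment> \<open>Completing the square: the value at \<open>(p, q)\<close> falls short of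
    \<open>S\<close> by \<open>M\<close> at the displacement from \<open>(p0, q0)\<close>.\<close>
  have "M (p - p0) (q - q0) = M p q - 2 * (p \<bullet> x + q \<bullet> g) + M p0 q0"
    unfolding lin M_eq
    by (simp add: matrix_vector_mult_diff_distrib inner_diff_left inner_diff_right symKl[of p0 p]
        symKxy[of q0 q] inner_commute[of q0 q] algebra_simps)
  then show "2 * (p \<bullet> x + q \<bullet> g) - M p q \<le> S"
    using M_nonneg[of "p - p0" "q - q0"] SM by linarith
qed

text \<open>By homogeneity an optimiser of one problem can be rescaled into a test point for the
  other: that of \<open>S'\<close> by \<open>1 - \<tau>\<close>, that of \<open>S\<close> by
  \<open>1 / (1 + \<tau>)\<close>. This gives
  \<open>S / (1 + \<tau>) \<le> S' \<le> S / (1 - \<tau>)\<close>.\<close>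

lemma variational_value_compare:
  fixes L M M' :: "'a::real_vector \<Rightarrow> real" and S S' \<tau> :: real
  assumes L: "\<And>c z. L (c *\<^sub>R z) = c * L z"
    and M: "\<And>c z. M (c *\<^sub>R z) = c\<^sup>2 * M z"
    and S: "\<exists>z. S = 2 * L z - M z" "\<And>z. 2 * L z - M z \<le> S"
    and S': "\<exists>z. S' = 2 * L z - M' z" "\<And>z. 2 * L z - M' z \<le> S'"
    and \<tau>: "0 \<le> \<tau>" "\<tau> < 1" and close: "\<And>z. \<bar>M' z - M z\<bar> \<le> \<tau> * M z"
  shows "0 \<le> S" "\<bar>S - S'\<bar> \<le> \<tau> / (1 - \<tau>) * S"
proof -
  have "L 0 = 0" "M 0 = 0" using L[of 0 0] M[of 0 0] by simp_all
  then show S0: "0 \<le> S" using S(2)[of 0] by simp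
  obtain z where z: "S' = 2 * L z - M' z" using S'(1) by blast
  have "S' \<le> 2 * L z - (1 - \<tau>) * M z"
    using z close[of z] by (simp add: abs_le_iff algebra_simps)
  also have "\<dots> = (2 * L ((1 - \<tau>) *\<^sub>R z) - M ((1 - \<tau>) *\<^sub>R z)) / (1 - \<tau>)"
    using \<tau> unfolding L M by (simp add: power2_eq_square field_simps)
  also have "\<dots> \<le> S / (1 - \<tau>)" using S(2) \<tau> by (intro divide_right_mono) auto
  finally have 1: "S' - S \<le> \<tau> / (1 - \<tau>) * S" using \<tau> by (simp add: field_simps)
  obtain y where y: "S = 2 * L y - M y" using S(1) by blast
  let ?y = "(1 / (1 + \<tau>)) *\<^sub>R y"
  have "S / (1 + \<tau>) = 2 * L ?y - (1 + \<tau>) * M ?y"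
    using \<tau> unfolding L M y by (simp add: power2_eq_square divide_simps)
  also have "\<dots> \<le> 2 * L ?y - M' ?y"
    using close[of ?y] by (simp add: abs_le_iff algebra_simps)
  also have "\<dots> \<le> S'" by (rule S'(2))
  finally have "S - S' \<le> S - S / (1 + \<tau>)" by simp
  also have "\<dots> = \<tau> / (1 + \<tau>) * S" using \<tau> by (simp add: field_simps)
  also have "\<dots> \<le> \<tau> / (1 - \<tau>) * S" using \<tau> S0 by (intro mult_right_mono divide_left_mono) auto
  finally show "\<bar>S - S'\<bar> \<le> \<tau> / (1 - \<tau>) * S" using 1 by (simp add: abs_le_iff)
qed

section \<open>Perturbation of the risk under entrywise errors\<close>

text \<open>Each bilinear part changes by at most \<open>\<eta>\<close> times a product of 1-norms,
  and Cauchy-Schwarz bounds a squared 1-norm by \<open>CARD('n)\<close> times the squared Euclidean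
  norm.\<close>

lemma block_form_diff_le:
  fixes K Ky Kxy K' Ky' Kxy' :: "real^'n^'n"
  assumes "\<And>i j. \<bar>K' $ i $ j - K $ i $ j\<bar> \<le> \<eta>" "\<And>i j. \<bar>Ky' $ i $ j - Ky $ i $ j\<bar> \<le> \<eta>"
    "\<And>i j. \<bar>Kxy' $ i $ j - Kxy $ i $ j\<bar> \<le> \<eta>"
  shows "\<bar>block_form K' Ky' Kxy' p q - block_form K Ky Kxy p q\<bar> \<le> 2 * real CARD('n) * \<eta> * (p \<bullet> p + q \<bullet> q)"
proof -
  have \<eta>: "\<eta> \<ge> 0" using assms(1) by (meson abs_ge_zero order_trans)
  define P Q where "P = (\<Sum>i\<in>UNIV. \<bar>p $ i\<bar>)" and "Q = (\<Sum>i\<in>UNIV. \<bar>q $ i\<bar>)"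
  have bil: "\<bar>a \<bullet> (N' *v b) - a \<bullet> (N *v b)\<bar> \<le> \<eta> * (\<Sum>i\<in>UNIV. \<bar>a $ i\<bar>) * (\<Sum>i\<in>UNIV. \<bar>b $ i\<bar>)"
    if "\<And>i j. \<bar>N' $ i $ j - N $ i $ j\<bar> \<le> \<eta>" for N N' :: "real^'n^'n" and a b
  proof -
    have "a \<bullet> (N' *v b) - a \<bullet> (N *v b) = (\<Sum>i\<in>UNIV. \<Sum>j\<in>UNIV. a $ i * ((N' $ i $ j - N $ i $ j) * b $ j))"
      by (simp add: inner_vec_def matrix_vector_mult_def sum_distrib_left sum_subtractf algebra_simps)
    also have "\<bar>\<dots>\<bar> \<le> (\<Sum>i\<in>UNIV. \<Sum>j\<in>UNIV. \<bar>a $ i\<bar> * (\<eta> * \<bar>b $ j\<bar>))"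
      by (intro order_trans[OF sum_abs] sum_mono)
         (auto simp: abs_mult intro!: mult_left_mono mult_right_mono that)
    also have "\<dots> = \<eta> * (\<Sum>i\<in>UNIV. \<bar>a $ i\<bar>) * (\<Sum>i\<in>UNIV. \<bar>b $ i\<bar>)"
      by (simp add: sum_product sum_distrib_left algebra_simps)
    finally show ?thesis .
  qed
  have sq: "(\<Sum>i\<in>UNIV. \<bar>a $ i\<bar>)\<^sup>2 \<le> real CARD('n) * (a \<bullet> a)" for a :: "real^'n"
    using sum_squared_le_sum_of_squares[of "\<lambda>i. \<bar>a $ i\<bar>" UNIV]
    by (simp add: inner_vec_def power2_eq_square mult.commute)
  have "\<bar>block_form K' Ky' Kxy' p q - block_form K Ky Kxy p q\<bar> \<le> \<eta> * P * P + 2 * (\<eta> * P * Q) + \<eta> * Q * Q"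
    using bil[OF assms(1), of p p] bil[OF assms(2), of p q] bil[OF assms(3), of q q]
    unfolding block_form_def P_def Q_def by linarith
  also have "\<dots> = \<eta> * (P + Q)\<^sup>2" by (simp add: power2_eq_square algebra_simps)
  also have "\<dots> \<le> \<eta> * (2 * P\<^sup>2 + 2 * Q\<^sup>2)"
    using \<eta> zero_le_power2[of "P - Q"] by (intro mult_left_mono) (auto simp: power2_eq_square algebra_simps)
  also have "\<dots> \<le> \<eta> * (2 * (real CARD('n) * (p \<bullet> p)) + 2 * (real CARD('n) * (q \<bullet> q)))"
    using \<eta> sq[of p] sq[of q] unfolding P_def Q_def by (intro mult_left_mono) auto
  finally show ?thesis by (simp add: algebra_simps)
qed

text \<open>Regularisation makes \<open>M\<close> at least \<open>min lam gam\<close> times the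
  squared norm, which turns the absolute entry error into the relative error
  \<open>\<epsilon> / 2\<close>. The data misfit is common to both risks and only enlarges
  \<open>R\<close>.\<close>

lemma risk_form_compare:
  fixes K Kx Ky Kxy K' Kx' Ky' Kxy' :: "real^'n^'n"
    and f :: "real^'n \<Rightarrow> 'p \<Rightarrow> real^'n" and x y :: "real^'n" and \<theta> :: 'p
    and lam gam \<sigma> \<epsilon> \<eta> :: real
  assumes sym: "transpose K = K" "transpose Ky = Kx" "transpose Kxy = Kxy"
    and psd: "\<And>p q. block_form K Ky Kxy p q \<ge> 0"
    and sym': "transpose K' = K'" "transpose Ky' = Kx'" "transpose Kxy' = Kxy'"
    and psd': "\<And>p q. block_form K' Ky' Kxy' p q \<ge> 0"
    and close: "\<And>i j. \<bar>K' $ i $ j - K $ i $ j\<bar> \<le> \<eta>" "\<And>i j. \<bar>Ky' $ i $ j - Ky $ i $ j\<bar> \<le> \<eta>"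
      "\<And>i j. \<bar>Kxy' $ i $ j - Kxy $ i $ j\<bar> \<le> \<eta>"
    and pos: "lam > 0" "gam > 0" and \<epsilon>: "0 < \<epsilon>" "\<epsilon> < 1"
    and \<eta>: "4 * real CARD('n) * \<eta> \<le> \<epsilon> * min lam gam"
  defines "R \<equiv> risk_form K (D_mat lam K Kx) (A_mat lam K Kx Ky Kxy) lam gam \<sigma> y f x \<theta>"
    and "R' \<equiv> risk_form K' (D_mat lam K' Kx') (A_mat lam K' Kx' Ky' Kxy') lam gam \<sigma> y f x \<theta>"
  shows "0 \<le> R" "\<bar>R - R'\<bar> \<le> \<epsilon> * R"
proof -
  define S where "S = x \<bullet> (matrix_inv (K + mat lam) *v x) + (f x \<theta> - D_mat lam K Kx *v x) \<bullet>
      (matrix_inv (A_mat lam K Kx Ky Kxy + mat gam) *v (f x \<theta> - D_mat lam K Kx *v x))"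
  define S' where "S' = x \<bullet> (matrix_inv (K' + mat lam) *v x) + (f x \<theta> - D_mat lam K' Kx' *v x) \<bullet>
      (matrix_inv (A_mat lam K' Kx' Ky' Kxy' + mat gam) *v (f x \<theta> - D_mat lam K' Kx' *v x))"
  define L where "L = (\<lambda>z. fst z \<bullet> x + snd z \<bullet> f x \<theta>)"
  define M where "M = (\<lambda>z. block_form K Ky Kxy (fst z) (snd z) + lam * (fst z \<bullet> fst z) + gam * (snd z \<bullet> snd z))"
  define M' where "M' = (\<lambda>z. block_form K' Ky' Kxy' (fst z) (snd z) + lam * (fst z \<bullet> fst z) + gam * (snd z \<bullet> snd z))"
  note v = risk_form_variational[where x = x and g = "f x \<theta>", OF sym psd pos, folded S_def]
  note v' = risk_form_variational[where x = x and g = "f x \<theta>", OF sym' psd' pos, folded S'_def]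
  have close': "\<bar>M' z - M z\<bar> \<le> \<epsilon> / 2 * M z" for z
  proof -
    obtain p q where z: "z = (p, q)" by (cases z)
    have "\<bar>M' z - M z\<bar> \<le> 2 * real CARD('n) * \<eta> * (p \<bullet> p + q \<bullet> q)"
      using block_form_diff_le[OF close, of p q] by (simp add: M_def M'_def z)
    also have "\<dots> \<le> \<epsilon> / 2 * min lam gam * (p \<bullet> p + q \<bullet> q)"
      using \<eta> by (intro mult_right_mono) auto
    also have "\<dots> = \<epsilon> / 2 * (min lam gam * (p \<bullet> p) + min lam gam * (q \<bullet> q))"
      by (simp add: algebra_simps)
    also have "\<dots> \<le> \<epsilon> / 2 * M z"
    proof (rule mult_left_mono)
      have "min lam gam * (p \<bullet> p) \<le> lam * (p \<bullet> p)" "min lam gam * (q \<bullet> q) \<le> gam * (q \<bullet> q)"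
        by (intro mult_right_mono; simp)+
      then show "min lam gam * (p \<bullet> p) + min lam gam * (q \<bullet> q) \<le> M z"
        using psd[of p q] by (simp add: M_def z)
    qed (use \<epsilon> in simp)
    finally show ?thesis .
  qed
  have S: "0 \<le> S" "\<bar>S - S'\<bar> \<le> \<epsilon> / 2 / (1 - \<epsilon> / 2) * S"
  proof -
    have a: "L (c *\<^sub>R z) = c * L z" for c z by (simp add: L_def algebra_simps)
    have b: "M (c *\<^sub>R z) = c\<^sup>2 * M z" for c z
      by (simp add: M_def block_form_def matrix_vector_mult_scaleR power2_eq_square algebra_simps)
    have c: "\<exists>z. S = 2 * L z - M z" "2 * L z - M z \<le> S" "\<exists>z. S' = 2 * L z - M' z" "2 * L z - M' z \<le> S'" for z
      using v v' by (auto simp: L_def M_def M'_def)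
    show "0 \<le> S" "\<bar>S - S'\<bar> \<le> \<epsilon> / 2 / (1 - \<epsilon> / 2) * S"
      using variational_value_compare[OF a b c(1,2) c(3,4) _ _ close'] \<epsilon> by simp_all
  qed
  \<comment> \<open>The quotient is \<open>\<epsilon> / (2 - \<epsilon>)\<close>, at most
    \<open>\<epsilon>\<close> because \<open>\<epsilon> < 1\<close>.\<close>
  have "\<epsilon> / 2 / (1 - \<epsilon> / 2) * S \<le> \<epsilon> * S"
    using \<epsilon> S(1) by (intro mult_right_mono) (auto simp: field_simps)
  moreover define d where "d = (x - y) \<bullet> (inverse (\<sigma>\<^sup>2) *\<^sub>R (x - y))"
  have d: "d \<ge> 0" by (simp add: d_def)
  moreover have "R = S + d" "R' = S' + d"
    by (simp_all add: R_def R'_def risk_form_def S_def S'_def d_def)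
  moreover have "\<epsilon> * S \<le> \<epsilon> * (S + d)" using \<epsilon> d by (intro mult_left_mono) auto
  ultimately show "0 \<le> R" "\<bar>R - R'\<bar> \<le> \<epsilon> * R" using S by simp_all
qed

section \<open>The kernel matrices and their approximations\<close>

lemma deriv_tower_cmult: "deriv_tower F \<Longrightarrow> deriv_tower (\<lambda>k x. c * F k x)"
  unfolding deriv_tower_def by (auto intro!: derivative_eq_intros)

text \<open>Leibniz rule for the factor \<open>x\<close>, of which only two terms survive. At
  \<open>k = 0\<close> the truncated index \<open>k - 1\<close> is harmless because its coefficient
  is 0.\<close>

lemma deriv_tower_mult_id:
  assumes "deriv_tower F"
  shows "deriv_tower (\<lambda>k x. x * F k x + real k * F (k - 1) x)"
  unfolding deriv_tower_def
proof (intro allI)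
  fix k x
  show "((\<lambda>x. x * F k x + real k * F (k - 1) x) has_real_derivative
      x * F (Suc k) x + real (Suc k) * F (Suc k - 1) x) (at x)"
    by (cases k) (auto intro!: derivative_eq_intros deriv_towerD[OF assms] simp: algebra_simps)
qed

text \<open>Differentiation multiplies by \<open>a\<close> and advances the phase by a quarter
  turn.\<close>

lemma deriv_tower_cos: "deriv_tower (\<lambda>k x. a ^ k * cos (a * x + real k * (pi / 2)))"
  unfolding deriv_tower_def
proof (intro allI)
  fix k x
  have "a * x + real (Suc k) * (pi / 2) = (a * x + real k * (pi / 2)) + pi / 2"
    by (simp add: field_simps)
  then have "cos (a * x + real (Suc k) * (pi / 2)) = - sin (a * x + real k * (pi / 2))"
    by (simp only: cos_add[of _ "pi / 2"]) simp
  then show "((\<lambda>x. a ^ k * cos (a * x + real k * (pi / 2))) has_real_derivative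
      a ^ Suc k * cos (a * x + real (Suc k) * (pi / 2))) (at x)"
    by (auto intro!: derivative_eq_intros)
qed

lemma deriv_tower_sin: "deriv_tower (\<lambda>k x. a ^ k * sin (a * x + real k * (pi / 2)))"
  unfolding deriv_tower_def
proof (intro allI)
  fix k x
  have "a * x + real (Suc k) * (pi / 2) = (a * x + real k * (pi / 2)) + pi / 2"
    by (simp add: field_simps)
  then have "sin (a * x + real (Suc k) * (pi / 2)) = cos (a * x + real k * (pi / 2))"
    by (simp only: sin_add[of _ "pi / 2"]) simp
  then show "((\<lambda>x. a ^ k * sin (a * x + real k * (pi / 2))) has_real_derivative
      a ^ Suc k * sin (a * x + real (Suc k) * (pi / 2))) (at x)"
    by (auto intro!: derivative_eq_intros)
qed

text \<open>The shape of the bound is stable under multiplication by \<open>B * x\<close>: every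
  such factor raises the exponent \<open>d\<close> by one.\<close>

lemma deriv_tower_mult_id_bound:
  fixes B :: real
  assumes "B > 0" "\<And>k x. \<bar>F k x\<bar> \<le> B ^ k * (B * \<bar>x\<bar> + real k) ^ d"
  shows "\<bar>B * (x * F k x + real k * F (k - 1) x)\<bar> \<le> B ^ k * (B * \<bar>x\<bar> + real k) ^ Suc d"
proof (cases k)
  case 0
  then show ?thesis using assms(1) assms(2)[of 0 x] by (simp add: abs_mult mult_left_mono)
next
  case (Suc j)
  let ?s = "(B * \<bar>x\<bar> + real k) ^ d"
  have "\<bar>F j x\<bar> \<le> B ^ j * (B * \<bar>x\<bar> + real j) ^ d" by (rule assms(2))
  also have "\<dots> \<le> B ^ j * ?s" using assms(1) Suc by (intro mult_left_mono power_mono) auto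
  finally have j: "\<bar>F j x\<bar> \<le> B ^ j * ?s" .
  have "\<bar>B * (x * F k x + real k * F j x)\<bar> \<le> B * (\<bar>x\<bar> * \<bar>F k x\<bar> + real k * \<bar>F j x\<bar>)"
    using assms(1) abs_triangle_ineq[of "x * F k x" "real k * F j x"] by (simp add: abs_mult)
  also have "\<dots> \<le> B * (\<bar>x\<bar> * (B ^ k * ?s) + real k * (B ^ j * ?s))"
    using assms j by (intro mult_left_mono add_mono) auto
  also have "\<dots> = B ^ k * (B * \<bar>x\<bar> + real k) ^ Suc d" using Suc by (simp add: algebra_simps)
  finally show ?thesis using Suc by simp
qed

text \<open>For \<open>b = sqrt 2 / l\<close> and \<open>r = x - y\<close>, the functions of the frequency \<open>w\<close> whose Gaussian integrals and
  quadrature sums give (up to the factor \<open>\<rho> / sqrt pi\<close>) the exact and the approximate kernel, and their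
  derivatives in \<open>y\<close> and in \<open>x, y\<close>.\<close>

definition feature_kernel :: "real \<Rightarrow> real \<Rightarrow> real \<Rightarrow> real" where
  "feature_kernel b r w = cos (b * r * w)"

definition feature_kernel_dy :: "real \<Rightarrow> real \<Rightarrow> real \<Rightarrow> real" where
  "feature_kernel_dy b r w = b * (w * sin (b * r * w))"

definition feature_kernel_dxdy :: "real \<Rightarrow> real \<Rightarrow> real \<Rightarrow> real" where
  "feature_kernel_dxdy b r w = b * (w * (b * (w * cos (b * r * w))))"

lemma exp_bounded_feature_kernel [intro!]:
  "exp_bounded (feature_kernel b r)" "exp_bounded (feature_kernel_dy b r)" "exp_bounded (feature_kernel_dxdy b r)"
  unfolding feature_kernel_def[abs_def] feature_kernel_dy_def[abs_def] feature_kernel_dxdy_def[abs_def] by auto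

section \<open>Quadrature errors of the feature functions\<close>

text \<open>The base of the power \<open>d\<close> is at least 1, so \<open>d = 2\<close> is the
  worst case. With \<open>b \<le> 2 * m\<close> the growth factor is then at most
  \<open>8 * m\<^sup>2 * (1 + x\<^sup>2)\<close>, the form that the Hermite majorant
  handles.\<close>

lemma quad_error_growth:
  fixes \<omega> W :: "real^'m"
  assumes rule: "gauss_hermite_rule \<omega> W" and F: "deriv_tower F" "exp_bounded (F 0)"
    and b: "0 < b" "b \<le> 2 * real CARD('m)" and d: "d \<le> 2"
    and bound: "\<And>x. \<bar>F (2 * CARD('m)) x\<bar> \<le> b ^ (2 * CARD('m)) * (b * \<bar>x\<bar> + real (2 * CARD('m))) ^ d"
  shows "\<bar>gauss_int (F 0) - quad \<omega> W (F 0)\<bar> \<le> 16 * (real CARD('m))\<^sup>2 * b ^ (2 * CARD('m)) *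
    sqrt pi * fact CARD('m) / (2 ^ CARD('m) * fact (2 * CARD('m)))"
proof -
  let ?m = "CARD('m)"
  have m: "1 \<le> real ?m" by simp
  have "\<bar>F (2 * ?m) x\<bar> \<le> 8 * (real ?m)\<^sup>2 * b ^ (2 * ?m) * (1 + x\<^sup>2)" for x
  proof -
    have "0 \<le> b * \<bar>x\<bar>" using b by simp
    then have "1 \<le> b * \<bar>x\<bar> + real (2 * ?m)"
      using m unfolding of_nat_mult of_nat_numeral by linarith
    then have "(b * \<bar>x\<bar> + real (2 * ?m)) ^ d \<le> (b * \<bar>x\<bar> + real (2 * ?m))\<^sup>2"
      using d by (rule power_increasing[rotated])
    also have "\<dots> \<le> (2 * real ?m * \<bar>x\<bar> + 2 * real ?m)\<^sup>2"
      using b by (intro power_mono add_mono mult_right_mono) auto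
    also have "\<dots> = 4 * (real ?m)\<^sup>2 * (1 + \<bar>x\<bar>)\<^sup>2" by (simp add: power2_eq_square algebra_simps)
    also have "\<dots> \<le> 4 * (real ?m)\<^sup>2 * (2 * (1 + x\<^sup>2))"
      using zero_le_power2[of "1 - \<bar>x\<bar>"]
      by (intro mult_left_mono) (auto simp: power2_diff power2_sum)
    finally have "b ^ (2 * ?m) * (b * \<bar>x\<bar> + real (2 * ?m)) ^ d
        \<le> b ^ (2 * ?m) * (4 * (real ?m)\<^sup>2 * (2 * (1 + x\<^sup>2)))"
      using b by (intro mult_left_mono) auto
    then show ?thesis using bound[of x] by (simp add: algebra_simps)
  qed
  from quad_error_le[OF rule F this] show ?thesis by (simp add: algebra_simps)
qed

lemma quad_error_feature_kernel:
  fixes \<omega> W :: "real^'m"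
  assumes rule: "gauss_hermite_rule \<omega> W" and b: "0 < b" "b \<le> 2 * real CARD('m)" and r: "\<bar>r\<bar> \<le> 1"
  defines "E \<equiv> 16 * (real CARD('m))\<^sup>2 * b ^ (2 * CARD('m)) *
    sqrt pi * fact CARD('m) / (2 ^ CARD('m) * fact (2 * CARD('m)))"
  shows "\<bar>gauss_int (feature_kernel b r) - quad \<omega> W (feature_kernel b r)\<bar> \<le> E"
    and "\<bar>gauss_int (feature_kernel_dy b r) - quad \<omega> W (feature_kernel_dy b r)\<bar> \<le> E"
    and "\<bar>gauss_int (feature_kernel_dxdy b r) - quad \<omega> W (feature_kernel_dxdy b r)\<bar> \<le> E"
proof -
  \<comment> \<open>\<open>D\<close> multiplies by \<open>b * x\<close>, so the three functions are
    the bottom levels of \<open>C\<close>, \<open>D S\<close> and \<open>D (D C)\<close>.\<close>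
  define D where "D = (\<lambda>(F :: nat \<Rightarrow> real \<Rightarrow> real) k x. b * (x * F k x + real k * F (k - 1) x))"
  have D: "deriv_tower (D F)" if "deriv_tower F" for F
    unfolding D_def using that by (intro deriv_tower_cmult deriv_tower_mult_id)
  have D_bound: "\<bar>D F k x\<bar> \<le> b ^ k * (b * \<bar>x\<bar> + real k) ^ Suc d"
    if "\<And>k x. \<bar>F k x\<bar> \<le> b ^ k * (b * \<bar>x\<bar> + real k) ^ d" for F k x d
    unfolding D_def using b(1) that by (rule deriv_tower_mult_id_bound)
  define C where "C = (\<lambda>k x. (b * r) ^ k * cos (b * r * x + real k * (pi / 2)))"
  define S where "S = (\<lambda>k x. (b * r) ^ k * sin (b * r * x + real k * (pi / 2)))"
  \<comment> \<open>Here \<open>\<bar>r\<bar> \<le> 1\<close> removes \<open>r\<close>, and the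
    resulting bound is uniform over all pairs of points.\<close>
  have pow: "\<bar>(b * r) ^ k\<bar> \<le> b ^ k" for k
    using b r by (simp add: power_abs abs_mult power_mono mult_left_le)
  have bC: "\<bar>C k x\<bar> \<le> b ^ k * (b * \<bar>x\<bar> + real k) ^ 0" and bS: "\<bar>S k x\<bar> \<le> b ^ k * (b * \<bar>x\<bar> + real k) ^ 0" for k x
    using mult_mono[OF pow[of k] abs_cos_le_one] mult_mono[OF pow[of k] abs_sin_le_one] b
    by (simp_all add: C_def S_def abs_mult)
  have tC: "deriv_tower C" and tS: "deriv_tower S"
    unfolding C_def S_def by (rule deriv_tower_cos deriv_tower_sin)+
  have 0: "C 0 = feature_kernel b r" "D S 0 = feature_kernel_dy b r" "D (D C) 0 = feature_kernel_dxdy b r"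
    by (simp_all add: fun_eq_iff C_def D_def S_def feature_kernel_def feature_kernel_dy_def feature_kernel_dxdy_def)
  show "\<bar>gauss_int (feature_kernel b r) - quad \<omega> W (feature_kernel b r)\<bar> \<le> E"
    unfolding E_def 0[symmetric]
    by (rule quad_error_growth[OF rule tC _ b _ bC]) (auto simp: 0)
  show "\<bar>gauss_int (feature_kernel_dy b r) - quad \<omega> W (feature_kernel_dy b r)\<bar> \<le> E"
    unfolding E_def 0[symmetric]
    by (rule quad_error_growth[OF rule D[OF tS] _ b _ D_bound[OF bS]]) (auto simp: 0)
  show "\<bar>gauss_int (feature_kernel_dxdy b r) - quad \<omega> W (feature_kernel_dxdy b r)\<bar> \<le> E"
    unfolding E_def 0[symmetric]
    by (rule quad_error_growth[OF rule D[OF D[OF tC]] _ b _ D_bound[OF D_bound[OF bC]]]) (auto simp: 0)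
qed

section \<open>The kernel and its derivatives as Gaussian integrals\<close>

text \<open>Bochner's representation: the squared exponential is the Fourier transform of a Gaussian
  in the frequency.\<close>

lemma rbf_kernel_eq_gauss_int:
  assumes "l > 0"
  shows "rbf_kernel \<rho> l x y = \<rho> / sqrt pi * gauss_int (feature_kernel (sqrt 2 / l) (x - y))"
  unfolding feature_kernel_def[abs_def] gauss_int_cos rbf_kernel_def
  by (simp add: power_mult_distrib power_divide)

lemma rbf_kernel_has_dx:
  "((\<lambda>x. rbf_kernel \<rho> l x y) has_real_derivative
     \<rho> * exp (- ((x - y)\<^sup>2 / (2 * l\<^sup>2))) * (- ((x - y) / l\<^sup>2))) (at x)"
  unfolding rbf_kernel_def by (cases "l = 0") (auto intro!: derivative_eq_intros simp: field_simps)

lemma rbf_kernel_has_dy: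
  "((\<lambda>y. rbf_kernel \<rho> l x y) has_real_derivative
     \<rho> * exp (- ((x - y)\<^sup>2 / (2 * l\<^sup>2))) * ((x - y) / l\<^sup>2)) (at y)"
  unfolding rbf_kernel_def by (cases "l = 0") (auto intro!: derivative_eq_intros simp: field_simps)

text \<open>Both sides are evaluated in closed form, which avoids differentiation under the integral
  sign.\<close>

lemma deriv_rbf_kernel_eq_gauss_int:
  assumes l: "l > 0"
  shows "deriv (\<lambda>x. rbf_kernel \<rho> l x y) x = - (\<rho> / sqrt pi * gauss_int (feature_kernel_dy (sqrt 2 / l) (x - y)))"
    and "deriv (\<lambda>y. rbf_kernel \<rho> l x y) y = \<rho> / sqrt pi * gauss_int (feature_kernel_dy (sqrt 2 / l) (x - y))"
    and "deriv (\<lambda>x. deriv (\<lambda>y. rbf_kernel \<rho> l x y) y) x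
      = \<rho> / sqrt pi * gauss_int (feature_kernel_dxdy (sqrt 2 / l) (x - y))"
proof -
  let ?b = "sqrt 2 / l"
  have sq: "(?b * (x - y))\<^sup>2 / 4 = (x - y)\<^sup>2 / (2 * l\<^sup>2)" for x y
    by (simp add: power_mult_distrib power_divide)
  have b2: "?b * ?b = 2 / l\<^sup>2" by (simp add: power2_eq_square)
  have dy: "gauss_int (feature_kernel_dy ?b (x - y)) = sqrt pi * exp (- ((x - y)\<^sup>2 / (2 * l\<^sup>2))) * ((x - y) / l\<^sup>2)" for x y
  proof -
    have "gauss_int (feature_kernel_dy ?b (x - y))
        = (?b * ?b) * (x - y) / 2 * sqrt pi * exp (- ((x - y)\<^sup>2 / (2 * l\<^sup>2)))"
      unfolding feature_kernel_dy_def[abs_def] gauss_int_cmult gauss_int_x_sin sq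
      by (simp only: mult.assoc times_divide_eq_left times_divide_eq_right)
    moreover have "2 / l\<^sup>2 * d / 2 = d / l\<^sup>2" for d by simp
    ultimately show ?thesis unfolding b2 by (simp only: mult_ac)
  qed
  have dxdy: "gauss_int (feature_kernel_dxdy ?b (x - y))
      = sqrt pi * exp (- ((x - y)\<^sup>2 / (2 * l\<^sup>2))) * (1 / l\<^sup>2 - (x - y)\<^sup>2 / l ^ 4)" for x y
  proof -
    have "feature_kernel_dxdy ?b (x - y) = (\<lambda>w. ?b\<^sup>2 * (w\<^sup>2 * cos (?b * (x - y) * w)))"
      by (simp add: fun_eq_iff feature_kernel_dxdy_def power2_eq_square)
    then have "gauss_int (feature_kernel_dxdy ?b (x - y))
        = ?b\<^sup>2 * ((1 / 2 - (x - y)\<^sup>2 / (2 * l\<^sup>2)) * sqrt pi * exp (- ((x - y)\<^sup>2 / (2 * l\<^sup>2))))"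
      by (simp only: gauss_int_cmult gauss_int_x2_cos sq)
    also have "?b\<^sup>2 = 2 / l\<^sup>2" by (simp add: power_divide)
    finally show ?thesis
      using l by (simp add: divide_simps power2_eq_square power4_eq_xxxx) (simp add: algebra_simps)
  qed
  have "deriv (\<lambda>x. rbf_kernel \<rho> l x y) x = \<rho> * exp (- ((x - y)\<^sup>2 / (2 * l\<^sup>2))) * (- ((x - y) / l\<^sup>2))" for x y
    by (rule DERIV_imp_deriv rbf_kernel_has_dx)+
  then show "deriv (\<lambda>x. rbf_kernel \<rho> l x y) x = - (\<rho> / sqrt pi * gauss_int (feature_kernel_dy ?b (x - y)))"
    by (simp add: dy)
  have Dy: "deriv (\<lambda>y. rbf_kernel \<rho> l x y) y = \<rho> * exp (- ((x - y)\<^sup>2 / (2 * l\<^sup>2))) * ((x - y) / l\<^sup>2)" for x y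
    by (rule DERIV_imp_deriv rbf_kernel_has_dy)+
  then show "deriv (\<lambda>y. rbf_kernel \<rho> l x y) y = \<rho> / sqrt pi * gauss_int (feature_kernel_dy ?b (x - y))"
    by (simp add: dy)
  have "((\<lambda>x. \<rho> * exp (- ((x - y)\<^sup>2 / (2 * l\<^sup>2))) * ((x - y) / l\<^sup>2)) has_real_derivative
      \<rho> * exp (- ((x - y)\<^sup>2 / (2 * l\<^sup>2))) * (1 / l\<^sup>2 - (x - y)\<^sup>2 / l ^ 4)) (at x)"
    using l by (auto intro!: derivative_eq_intros simp: divide_simps power2_eq_square power4_eq_xxxx)
      (auto simp: algebra_simps)
  then show "deriv (\<lambda>x. deriv (\<lambda>y. rbf_kernel \<rho> l x y) y) x
      = \<rho> / sqrt pi * gauss_int (feature_kernel_dxdy ?b (x - y))"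
    unfolding Dy by (simp add: DERIV_imp_deriv dxdy)
qed

lemma feature_kernel_dy_minus: "feature_kernel_dy b (- r) = (\<lambda>w. - feature_kernel_dy b r w)"
  by (simp add: fun_eq_iff feature_kernel_dy_def)

text \<open>Up to the factor \<open>\<rho> / sqrt pi\<close> the form is the Gaussian integral of
  the squared modulus of the sum over \<open>j\<close> of
  \<open>(p $ j + i * b * w * q $ j) * exp (i * b * t $ j * w)\<close>, where \<open>i\<close> is
  the imaginary unit; \<open>?u\<close> and \<open>?v\<close> are the real and imaginary parts of
  its terms.\<close>

lemma block_form_kernel_nonneg:
  fixes t :: "real^'n"
  assumes l: "l > 0" and \<rho>: "\<rho> > 0"
  shows "block_form (kernel_mat \<rho> l t) (kernel_mat_dy \<rho> l t) (kernel_mat_dxdy \<rho> l t) p q \<ge> 0"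
proof -
  define b where "b = sqrt 2 / l"
  define G where "G = (\<lambda>w. \<Sum>i\<in>UNIV. \<Sum>j\<in>UNIV. (p $ i * p $ j) * feature_kernel b (t $ i - t $ j) w
      + 2 * (p $ i * q $ j) * feature_kernel_dy b (t $ i - t $ j) w + (q $ i * q $ j) * feature_kernel_dxdy b (t $ i - t $ j) w)"
  have "block_form (kernel_mat \<rho> l t) (kernel_mat_dy \<rho> l t) (kernel_mat_dxdy \<rho> l t) p q
     = (\<Sum>i\<in>UNIV. \<Sum>j\<in>UNIV. p $ i * p $ j * rbf_kernel \<rho> l (t $ i) (t $ j)
        + 2 * (p $ i * q $ j) * deriv (\<lambda>y. rbf_kernel \<rho> l (t $ i) y) (t $ j)
        + q $ i * q $ j * deriv (\<lambda>x. deriv (\<lambda>y. rbf_kernel \<rho> l x y) (t $ j)) (t $ i))"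
    by (simp add: block_form_def inner_vec_def matrix_vector_mult_def kernel_mat_def kernel_mat_dy_def
        kernel_mat_dxdy_def sum.distrib sum_distrib_left mult_ac)
  also have "\<dots> = \<rho> / sqrt pi * gauss_int G"
  proof -
    have "gauss_int G = (\<Sum>i\<in>UNIV. \<Sum>j\<in>UNIV. (p $ i * p $ j) * gauss_int (feature_kernel b (t $ i - t $ j))
      + 2 * (p $ i * q $ j) * gauss_int (feature_kernel_dy b (t $ i - t $ j))
      + (q $ i * q $ j) * gauss_int (feature_kernel_dxdy b (t $ i - t $ j)))"
      unfolding G_def
      by (simp add: gauss_int_sum gauss_int_add gauss_int_cmult exp_bounded_feature_kernel exp_bounded_add
          exp_bounded_mult exp_bounded_const exp_bounded_sum)
    then show ?thesis
      unfolding deriv_rbf_kernel_eq_gauss_int(3)[OF l]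
      unfolding deriv_rbf_kernel_eq_gauss_int(2)[OF l]
      unfolding rbf_kernel_eq_gauss_int[OF l]
      by (simp only: sum_distrib_left b_def[symmetric]) (simp add: algebra_simps)
  qed
  finally have eq: "block_form (kernel_mat \<rho> l t) (kernel_mat_dy \<rho> l t) (kernel_mat_dxdy \<rho> l t) p q
    = \<rho> / sqrt pi * gauss_int G" .
  have "gauss_int G \<ge> 0"
  proof (rule gauss_int_nonneg)
    fix w
    let ?c = "\<lambda>i. cos (b * t $ i * w)" and ?s = "\<lambda>i. sin (b * t $ i * w)" and ?z = "b * w"
    let ?u = "\<lambda>i. p $ i * ?c i - q $ i * ?z * ?s i" and ?v = "\<lambda>i. p $ i * ?s i + q $ i * ?z * ?c i"
    let ?A = "\<lambda>i j. p $ i * p $ j * feature_kernel b (t $ i - t $ j) w + q $ i * q $ j * feature_kernel_dxdy b (t $ i - t $ j) w"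
    let ?B = "\<lambda>i j. p $ i * q $ j * feature_kernel_dy b (t $ i - t $ j) w"
    have "(\<Sum>i\<in>UNIV. ?u i)\<^sup>2 + (\<Sum>i\<in>UNIV. ?v i)\<^sup>2 = (\<Sum>i\<in>UNIV. \<Sum>j\<in>UNIV. ?u i * ?u j + ?v i * ?v j)"
      by (simp only: power2_eq_square sum_product sum.distrib[symmetric])
    also have "\<dots> = (\<Sum>i\<in>UNIV. \<Sum>j\<in>UNIV. ?A i j + ?B i j + ?B j i)"
      by (intro sum.cong refl)
         (simp add: feature_kernel_def feature_kernel_dy_def feature_kernel_dxdy_def left_diff_distrib right_diff_distrib cos_diff sin_diff,
          simp add: algebra_simps)
    also have "\<dots> = (\<Sum>i\<in>UNIV. \<Sum>j\<in>UNIV. ?A i j) + (\<Sum>i\<in>UNIV. \<Sum>j\<in>UNIV. ?B i j) + (\<Sum>i\<in>UNIV. \<Sum>j\<in>UNIV. ?B j i)"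
      by (simp only: sum.distrib)
    \<comment> \<open>Exchanging the summation indices merges the two mixed terms into the doubled
      one of \<open>G\<close>.\<close>
    also have "(\<Sum>i\<in>UNIV. \<Sum>j\<in>UNIV. ?B j i) = (\<Sum>i\<in>UNIV. \<Sum>j\<in>UNIV. ?B i j)"
      by (rule sum.swap)
    also have "(\<Sum>i\<in>UNIV. \<Sum>j\<in>UNIV. ?A i j) + (\<Sum>i\<in>UNIV. \<Sum>j\<in>UNIV. ?B i j) + (\<Sum>i\<in>UNIV. \<Sum>j\<in>UNIV. ?B i j) = G w"
      by (simp add: G_def sum.distrib algebra_simps sum_distrib_left)
    finally have "G w = (\<Sum>i\<in>UNIV. ?u i)\<^sup>2 + (\<Sum>i\<in>UNIV. ?v i)\<^sup>2" by (rule sym)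
    then show "0 \<le> G w" by simp
  qed
  then show ?thesis unfolding eq using \<rho> by simp
qed

section \<open>Feature matrices and symmetry of the blocks\<close>

lemma qff_has_vector_derivative:
  fixes \<omega> W :: "real^'m" and \<rho> l s :: real
  defines "D \<equiv> \<lambda>s. \<chi> a. case a of
       Inl q \<Rightarrow> - (sqrt (\<rho> / sqrt pi) * sqrt (W $ q) * (\<omega> $ q * (sqrt 2 / l)) * sin (\<omega> $ q * (sqrt 2 / l) * s))
     | Inr q \<Rightarrow> sqrt (\<rho> / sqrt pi) * sqrt (W $ q) * (\<omega> $ q * (sqrt 2 / l)) * cos (\<omega> $ q * (sqrt 2 / l) * s)"
  shows "(qff \<rho> l \<omega> W has_vector_derivative D s) (at s)"
  unfolding has_vector_derivative_def
proof (subst has_derivative_componentwise_within, intro ballI)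
  fix i :: "real^('m + 'm)" assume "i \<in> Basis"
  then obtain a where i: "i = axis a 1" by (auto simp: Basis_vec_def)
  have "((\<lambda>x. qff \<rho> l \<omega> W x $ a) has_real_derivative D s $ a) (at s)"
  proof -
    have cos: "((\<lambda>x. A * cos (B * x)) has_real_derivative - (A * B * sin (B * s))) (at s)"
      and sin: "((\<lambda>x. A * sin (B * x)) has_real_derivative A * B * cos (B * s)) (at s)" for A B
      by (auto intro!: derivative_eq_intros)
    show ?thesis
      by (cases a; simp only: qff_def D_def vec_lambda_beta sum.case; rule cos sin)
  qed
  then show "((\<lambda>x. qff \<rho> l \<omega> W x \<bullet> i) has_derivative (\<lambda>x. (x *\<^sub>R D s) \<bullet> i)) (at s)"
    unfolding has_field_derivative_def i by (simp add: inner_axis mult.commute[of _ "D s $ a"])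
qed

lemma sum_UNIV_Plus:
  fixes g :: "'a::finite + 'b::finite \<Rightarrow> 'c::comm_monoid_add"
  shows "(\<Sum>a\<in>UNIV. g a) = (\<Sum>q\<in>UNIV. g (Inl q)) + (\<Sum>q\<in>UNIV. g (Inr q))"
  by (subst UNIV_Plus_UNIV[symmetric], subst sum.Plus) (auto simp: o_def)

text \<open>The cosine and sine features of one node combine by the addition formulas for the
  difference \<open>t $ i - t $ j\<close>.\<close>

lemma qff_gram_entries:
  fixes \<omega> W :: "real^'m" and t :: "real^'n" and \<rho> l :: real
  assumes W: "\<And>q. W $ q > 0" and \<rho>: "\<rho> > 0"
  defines "P \<equiv> qff_mat \<rho> l \<omega> W t" and "P' \<equiv> qff_mat_deriv \<rho> l \<omega> W t"
  shows "(transpose P ** P) $ i $ j = \<rho> / sqrt pi * quad \<omega> W (feature_kernel (sqrt 2 / l) (t $ i - t $ j))"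
    and "(transpose P ** P') $ i $ j = \<rho> / sqrt pi * quad \<omega> W (feature_kernel_dy (sqrt 2 / l) (t $ i - t $ j))"
    and "(transpose P' ** P') $ i $ j = \<rho> / sqrt pi * quad \<omega> W (feature_kernel_dxdy (sqrt 2 / l) (t $ i - t $ j))"
proof -
  define b where "b = sqrt 2 / l"
  define \<kappa> where "\<kappa> = sqrt (\<rho> / sqrt pi)"
  define c where "c = \<rho> / sqrt pi"
  have \<kappa>: "\<kappa> * \<kappa> = c" using \<rho> by (simp add: \<kappa>_def c_def)
  have sW: "sqrt (W $ q) * sqrt (W $ q) = W $ q" for q using less_imp_le[OF W[of q]] by simp
  have P: "P $ Inl q $ i = \<kappa> * sqrt (W $ q) * cos (\<omega> $ q * b * t $ i)"
    "P $ Inr q $ i = \<kappa> * sqrt (W $ q) * sin (\<omega> $ q * b * t $ i)" for q i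
    by (simp_all add: P_def qff_mat_def qff_def \<kappa>_def b_def)
  have P': "P' $ Inl q $ i = - (\<kappa> * sqrt (W $ q) * (\<omega> $ q * b * sin (\<omega> $ q * b * t $ i)))"
    "P' $ Inr q $ i = \<kappa> * sqrt (W $ q) * (\<omega> $ q * b * cos (\<omega> $ q * b * t $ i))" for q i
    unfolding P'_def qff_mat_deriv_def vector_derivative_at[OF qff_has_vector_derivative]
    by (simp_all add: \<kappa>_def b_def)
  \<comment> \<open>Two square-root amplitudes multiply to the quadrature weight times
    \<open>\<rho> / sqrt pi\<close>.\<close>
  have pull: "(\<kappa> * sqrt (W $ q) * x) * (\<kappa> * sqrt (W $ q) * y) = c * (W $ q * (x * y))" for q x y
    using arg_cong2[OF \<kappa> sW[of q], of "\<lambda>u v. u * v * (x * y)"] by (simp only: mult_ac)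
  have gram: "(transpose A ** B) $ i $ j = (\<Sum>q\<in>UNIV. A $ Inl q $ i * B $ Inl q $ j + A $ Inr q $ i * B $ Inr q $ j)"
    for A B :: "real^'n^('m + 'm)"
    by (simp add: matrix_matrix_mult_def transpose_def sum_UNIV_Plus sum.distrib)
  note simps = quad_def sum_distrib_left feature_kernel_def feature_kernel_dy_def feature_kernel_dxdy_def
    left_diff_distrib right_diff_distrib cos_diff sin_diff
  show "(transpose P ** P) $ i $ j = \<rho> / sqrt pi * quad \<omega> W (feature_kernel (sqrt 2 / l) (t $ i - t $ j))"
    unfolding gram P pull quad_def sum_distrib_left b_def[symmetric] c_def[symmetric]
    by (intro sum.cong refl) (simp add: simps, simp add: algebra_simps)
  show "(transpose P ** P') $ i $ j = \<rho> / sqrt pi * quad \<omega> W (feature_kernel_dy (sqrt 2 / l) (t $ i - t $ j))"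
    unfolding gram P P' mult_minus_right pull quad_def sum_distrib_left b_def[symmetric] c_def[symmetric]
    by (intro sum.cong refl) (simp add: simps, simp add: algebra_simps)
  show "(transpose P' ** P') $ i $ j = \<rho> / sqrt pi * quad \<omega> W (feature_kernel_dxdy (sqrt 2 / l) (t $ i - t $ j))"
    unfolding gram P' minus_mult_minus pull quad_def sum_distrib_left b_def[symmetric] c_def[symmetric]
    by (intro sum.cong refl) (simp add: simps, simp add: algebra_simps)
qed

text \<open>The form is the squared norm of \<open>P *v p + P' *v q\<close>.\<close>

lemma block_form_gram_nonneg:
  fixes P P' :: "real^'n^'k"
  shows "block_form (transpose P ** P) (transpose P ** P') (transpose P' ** P') p q \<ge> 0"
proof -
  have *: "a \<bullet> ((transpose A ** B) *v b) = (A *v a) \<bullet> (B *v b)" for A B :: "real^'n^'k" and a b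
    by (metis dot_lmul_matrix matrix_vector_mul_assoc vector_transpose_matrix)
  have "block_form (transpose P ** P) (transpose P ** P') (transpose P' ** P') p q
    = (P *v p + P' *v q) \<bullet> (P *v p + P' *v q)"
    by (simp add: block_form_def * inner_add_left inner_add_right inner_commute[of "P' *v q" "P *v p"])
  then show ?thesis by simp
qed

text \<open>As functions of \<open>x - y\<close>, the kernel and its mixed derivative are even and
  the first derivatives are odd; the sign is made up by exchanging the roles of \<open>x\<close> and
  \<open>y\<close>.\<close>

lemma transpose_kernel_mats:
  assumes "l > 0"
  shows "transpose (kernel_mat \<rho> l t) = kernel_mat \<rho> l t"
    and "transpose (kernel_mat_dy \<rho> l t) = kernel_mat_dx \<rho> l t"
    and "transpose (kernel_mat_dxdy \<rho> l t) = kernel_mat_dxdy \<rho> l t"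
proof -
  have minus: "gauss_int (feature_kernel_dy b (y - x)) = - gauss_int (feature_kernel_dy b (x - y))" for b x y
    using gauss_int_cmult[of "- 1" "feature_kernel_dy b (x - y)"] feature_kernel_dy_minus[of b "x - y"] by simp
  have sym: "feature_kernel_dxdy b (y - x) = feature_kernel_dxdy b (x - y)" for b x y
  proof
    fix w
    have "b * (y - x) * w = - (b * (x - y) * w)" by (simp add: algebra_simps)
    then show "feature_kernel_dxdy b (y - x) w = feature_kernel_dxdy b (x - y) w"
      by (simp only: feature_kernel_dxdy_def cos_minus)
  qed
  show "transpose (kernel_mat \<rho> l t) = kernel_mat \<rho> l t"
    by (simp add: vec_eq_iff transpose_def kernel_mat_def rbf_kernel_def power2_commute)
  show "transpose (kernel_mat_dy \<rho> l t) = kernel_mat_dx \<rho> l t"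
    unfolding vec_eq_iff
  proof (intro allI)
    fix i j
    show "transpose (kernel_mat_dy \<rho> l t) $ i $ j = kernel_mat_dx \<rho> l t $ i $ j"
      using minus[of "sqrt 2 / l" "t $ j" "t $ i"]
      by (simp add: transpose_def kernel_mat_dy_def kernel_mat_dx_def
          deriv_rbf_kernel_eq_gauss_int(1,2)[OF assms])
  qed
  show "transpose (kernel_mat_dxdy \<rho> l t) = kernel_mat_dxdy \<rho> l t"
    unfolding vec_eq_iff
  proof (intro allI)
    fix i j
    show "transpose (kernel_mat_dxdy \<rho> l t) $ i $ j = kernel_mat_dxdy \<rho> l t $ i $ j"
      unfolding transpose_def kernel_mat_dxdy_def vec_lambda_beta deriv_rbf_kernel_eq_gauss_int(3)[OF assms]
      by (simp only: sym[of _ "t $ i" "t $ j"])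
  qed
qed

section \<open>The order of the quadrature\<close>

text \<open>A bound of Stirling type, obtained from \<open>(1 + 1 / N) ^ N \<le> exp 1\<close>
  alone.\<close>

lemma fact_double_lower_bound: "(4 * real m) ^ m * fact m \<le> exp 1 ^ m * fact (2 * m)"
proof (cases "m = 0")
  case False
  \<comment> \<open>Passing from \<open>j\<close> to \<open>Suc j\<close> costs one factor
    \<open>exp 1\<close>. The case \<open>j = m\<close> gives the claim, since
    \<open>(2 * m) ^ (2 * m) = m ^ m * (4 * m) ^ m\<close>.\<close>
  have step: "(real m + real j) ^ (m + j) * fact m \<le> real m ^ m * exp 1 ^ j * fact (m + j)" for j
  proof (induction j)
    case (Suc j)
    let ?N = "m + j"
    have N: "real ?N > 0" using False by simp
    have "1 + 1 / real ?N \<le> exp (1 / real ?N)" by (rule exp_ge_add_one_self)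
    then have "(1 + 1 / real ?N) ^ ?N \<le> exp (1 / real ?N) ^ ?N" by (rule power_mono) simp
    also have "\<dots> = exp 1" using N by (simp flip: exp_of_nat_mult)
    finally have "(1 + 1 / real ?N) ^ ?N * real ?N ^ ?N \<le> exp 1 * real ?N ^ ?N"
      by (rule mult_right_mono) simp
    moreover have "(1 + 1 / real ?N) * real ?N = real ?N + 1" using N by (simp add: field_simps)
    ultimately have e: "(real ?N + 1) ^ ?N \<le> exp 1 * real ?N ^ ?N"
      by (simp flip: power_mult_distrib)
    have "(real m + real (Suc j)) ^ (m + Suc j) * fact m = (real ?N + 1) * ((real ?N + 1) ^ ?N * fact m)"
      by (simp add: algebra_simps)
    also have "\<dots> \<le> (real ?N + 1) * ((exp 1 * real ?N ^ ?N) * fact m)"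
      using e by (intro mult_left_mono mult_right_mono) auto
    also have "\<dots> = (real ?N + 1) * exp 1 * ((real m + real j) ^ ?N * fact m)" by (simp add: mult_ac)
    also have "\<dots> \<le> (real ?N + 1) * exp 1 * (real m ^ m * exp 1 ^ j * fact ?N)"
      using Suc.IH by (intro mult_left_mono) auto
    also have "\<dots> = real m ^ m * exp 1 ^ Suc j * fact (m + Suc j)" by (simp add: algebra_simps)
    finally show ?case .
  qed simp
  have "real m ^ m * ((4 * real m) ^ m * fact m) = (real m + real m) ^ (m + m) * fact m"
  proof -
    have "(real m + real m) ^ (m + m) = (2 * real m) ^ m * (2 * real m) ^ m"
      unfolding power_add mult_2 by (rule refl)
    also have "\<dots> = ((2 * real m) * (2 * real m)) ^ m" by (rule power_mult_distrib[symmetric])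
    also have "(2 * real m) * (2 * real m) = real m * (4 * real m)" by simp
    also have "(real m * (4 * real m)) ^ m = real m ^ m * (4 * real m) ^ m" by (rule power_mult_distrib)
    finally show ?thesis by simp
  qed
  also have "\<dots> \<le> real m ^ m * (exp 1 ^ m * fact (2 * m))" 
    using step[of m] unfolding mult_2 mult.assoc .
  finally show ?thesis using False mult_le_cancel_left_pos[of "real m ^ m"] by simp
qed simp

text \<open>With \<open>k = min l 1\<close> and \<open>x = exp 1 / (2 * k\<^sup>2)\<close>, the
  factorial bound reduces the error to \<open>16 * m\<^sup>2 * (x / m) ^ m / 2 ^ m\<close>. As
  \<open>x \<le> m\<close>, two factors \<open>x / m\<close> absorb \<open>m\<^sup>2\<close> and the
  others are at most 1; \<open>exp 1 \<le> 3\<close> gives the constant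
  \<open>16 * 9 / 4 = 36\<close>.\<close>

lemma quad_error_constant:
  fixes m :: nat and l :: real
  assumes l: "0 < l" and m: "m \<ge> 2" "exp 1 / (2 * (min l 1)\<^sup>2) \<le> real m"
  shows "16 * (real m)\<^sup>2 * (sqrt 2 / l) ^ (2 * m) * fact m / (2 ^ m * fact (2 * m))
      \<le> 36 / (2 ^ m * (min l 1) ^ 4)" "sqrt 2 / l \<le> 2 * real m"
proof -
  define k where "k = min l 1"
  define x where "x = exp 1 / (2 * k\<^sup>2)"
  have k: "0 < k" "k \<le> l" using l by (auto simp: k_def)
  have x: "0 < x" "x \<le> real m" using k m by (auto simp: x_def k_def)
  have mpos: "real m > 0" using m by simp
  have b2: "(sqrt 2 / l)\<^sup>2 \<le> 2 / k\<^sup>2"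
    using k l by (simp add: power_divide frac_le power_mono)
  have "(2::real) / k\<^sup>2 \<le> 4 * x"
    using k exp_ge_add_one_self[of 1] by (simp add: x_def divide_simps)
  also have "\<dots> \<le> 4 * real m * real m" using x m by (simp add: mult_le_cancel_left1 order_trans[of x "real m"])
  also have "\<dots> = (2 * real m)\<^sup>2" by (simp add: power2_eq_square)
  finally show "sqrt 2 / l \<le> 2 * real m" using b2 by (intro power2_le_imp_le[of "sqrt 2 / l"]) auto
  have "fact m / fact (2 * m) \<le> (exp 1 / (4 * real m)) ^ m"
    using fact_double_lower_bound[of m] mpos by (simp add: power_divide field_simps)
  moreover have "(sqrt 2 / l) ^ (2 * m) / 2 ^ m \<le> (1 / k\<^sup>2) ^ m"
  proof -
    have "(sqrt 2 / l) ^ (2 * m) \<le> (2 / k\<^sup>2) ^ m"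
      unfolding power_mult using b2 by (intro power_mono) auto
    then have "(sqrt 2 / l) ^ (2 * m) / 2 ^ m \<le> (2 / k\<^sup>2) ^ m / 2 ^ m" by (rule divide_right_mono) simp
    also have "\<dots> = (1 / k\<^sup>2) ^ m" by (simp add: power_divide)
    finally show ?thesis .
  qed
  ultimately have "(sqrt 2 / l) ^ (2 * m) / 2 ^ m * (fact m / fact (2 * m)) \<le> (1 / k\<^sup>2) ^ m * (exp 1 / (4 * real m)) ^ m"
    using l by (intro mult_mono) auto
  also have "\<dots> = (x / real m) ^ m / 2 ^ m"
    by (simp add: x_def mult_ac flip: power_mult_distrib power_divide)
  finally have 1: "(sqrt 2 / l) ^ (2 * m) / 2 ^ m * (fact m / fact (2 * m)) \<le> (x / real m) ^ m / 2 ^ m" .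
  have "(x / real m) ^ m \<le> (x / real m) ^ 2" using m x mpos by (intro power_decreasing) auto
  then have 2: "(real m)\<^sup>2 * (x / real m) ^ m \<le> x\<^sup>2"
    using mpos by (simp add: power_divide field_simps)
  have 3: "x\<^sup>2 \<le> 9 / (4 * k ^ 4)"
  proof -
    have "(exp (1::real))\<^sup>2 \<le> 3\<^sup>2" using exp_le by (intro power_mono) auto
    then show ?thesis using k by (simp add: x_def power_divide power_mult_distrib divide_simps)
  qed
  have "16 * (real m)\<^sup>2 * (sqrt 2 / l) ^ (2 * m) * fact m / (2 ^ m * fact (2 * m))
      = 16 * (real m)\<^sup>2 * ((sqrt 2 / l) ^ (2 * m) / 2 ^ m * (fact m / fact (2 * m)))" by simp
  also have "\<dots> \<le> 16 * (real m)\<^sup>2 * ((x / real m) ^ m / 2 ^ m)" using 1 by (intro mult_left_mono) auto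
  also have "\<dots> = 16 * ((real m)\<^sup>2 * (x / real m) ^ m) / 2 ^ m" by simp
  also have "\<dots> \<le> 16 * (9 / (4 * k ^ 4)) / 2 ^ m"
    using 2 3 by (intro divide_right_mono mult_left_mono) auto
  also have "\<dots> = 36 / (2 ^ m * k ^ 4)" by simp
  finally show "16 * (real m)\<^sup>2 * (sqrt 2 / l) ^ (2 * m) * fact m / (2 ^ m * fact (2 * m))
      \<le> 36 / (2 ^ m * (min l 1) ^ 4)" by (simp add: k_def)
qed

text \<open>Exponentiation gives \<open>1024 * X \<le> 2 ^ m\<close>. The factor 1024, from the
  summand 10, covers \<open>4 * 36 = 144\<close>; \<open>\<rho> \<le> r\<^sup>2\<close>,
  \<open>n \<le> n ^ 3\<close> and \<open>a\<^sup>2 * c \<le> min lam gam\<close> do the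
  rest.\<close>

lemma order_suffices:
  fixes m n :: nat and \<rho> l lam gam \<epsilon> :: real
  assumes pos: "\<rho> > 0" "l > 0" "lam > 0" "gam > 0" "\<epsilon> > 0" and n: "n > 0"
    and m: "real m \<ge> 10 + log 2 ((max \<rho> 1)\<^sup>2 * real n ^ 3 /
              ((min lam 1)\<^sup>2 * min gam 1 * (min l 1) ^ 4 * \<epsilon>))"
  shows "4 * real n * (\<rho> * (36 / (2 ^ m * (min l 1) ^ 4))) \<le> \<epsilon> * min lam gam"
proof -
  define r where "r = max \<rho> 1"
  define k where "k = min l 1"
  define a where "a = min lam 1"
  define c where "c = min gam 1"
  define X where "X = r\<^sup>2 * real n ^ 3 / (a\<^sup>2 * c * k ^ 4 * \<epsilon>)"
  have ps: "r \<ge> 1" "\<rho> \<le> r" "k > 0" "a > 0" "a \<le> 1" "a \<le> lam" "c > 0" "c \<le> 1" "c \<le> gam"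
    using pos by (auto simp: r_def k_def a_def c_def)
  have N: "real n \<ge> 1" using n by simp
  have X: "X > 0" using ps pos N by (simp add: X_def)
  have "2 powr (10 + log 2 X) \<le> 2 powr real m" using m by (simp add: X_def r_def k_def a_def c_def)
  then have "1024 * X \<le> 2 ^ m" using X by (simp add: powr_add powr_realpow)
  then have le: "1024 * (r\<^sup>2 * real n ^ 3) \<le> 2 ^ m * (a\<^sup>2 * c * k ^ 4 * \<epsilon>)"
    using ps pos by (simp add: X_def field_simps)
  have "1024 * (\<rho> * real n) \<le> 1024 * (r\<^sup>2 * real n ^ 3)"
  proof -
    have "\<rho> \<le> r\<^sup>2" using ps power_increasing[of 1 2 r] by simp
    moreover have "real n \<le> real n ^ 3" using N power_increasing[of 1 3 "real n"] by simp
    ultimately show ?thesis using pos by (simp add: mult_mono)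
  qed
  also have "\<dots> \<le> 2 ^ m * (a\<^sup>2 * c * k ^ 4 * \<epsilon>)" by (rule le)
  also have "\<dots> = (2 ^ m * k ^ 4) * (\<epsilon> * (a * (a * c)))" by (simp add: power2_eq_square)
  finally have 1: "1024 * (\<rho> * real n) / (2 ^ m * k ^ 4) \<le> \<epsilon> * (a * (a * c))"
    using ps by (simp add: field_simps)
  have "4 * real n * (\<rho> * (36 / (2 ^ m * k ^ 4))) \<le> 1024 * (\<rho> * real n) / (2 ^ m * k ^ 4)"
    using ps pos N by (simp add: field_simps)
  also note 1
  also have "\<epsilon> * (a * (a * c)) \<le> \<epsilon> * min lam gam"
  proof -
    have "a * c \<le> 1" "a * a \<le> 1" using ps by (simp_all add: mult_le_one)
    then have "a * (a * c) \<le> a * 1" "c * (a * a) \<le> c * 1" using ps by (intro mult_left_mono; simp)+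
    moreover have "c * (a * a) = a * (a * c)" by simp
    ultimately have "a * (a * c) \<le> lam" "a * (a * c) \<le> gam" using ps by linarith+
    then have "a * (a * c) \<le> min lam gam" by simp
    then show ?thesis using ps pos by (intro mult_left_mono) auto
  qed
  finally show ?thesis by (simp add: k_def)
qed

section \<open>The risk\<close>

theorem theorem4:
  fixes t y :: "real^'n"
    and \<rho> l lam \<gamma> \<sigma> \<epsilon> :: real
    and f :: "real^'n \<Rightarrow> 'p \<Rightarrow> real^'n"
    and \<omega> W :: "real^'m"
  assumes "CARD('n) \<ge> 60"
    and "\<And>i. t $ i \<in> {0..1}"
    and "inj (\<lambda>i. t $ i)"
    and "\<rho> > 0" "l > 0" "lam > 0" "\<gamma> > 0" "\<sigma> > 0"
    and "0 < \<epsilon>" "\<epsilon> < 1"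
    and "gauss_hermite_rule \<omega> W"
    and "real CARD('m) \<ge> 10 + max (exp 1 / (2 * (min l 1)\<^sup>2))
           (log 2 ((max \<rho> 1)\<^sup>2 * real CARD('n) ^ 3 /
              ((min lam 1)\<^sup>2 * min \<gamma> 1 * (min l 1) ^ 4 * \<epsilon>)))"
  shows "\<forall>x \<theta>. odin_risk \<rho> l t lam \<gamma> \<sigma> y f x \<theta> \<noteq> 0 \<longrightarrow>
           \<bar>odin_risk \<rho> l t lam \<gamma> \<sigma> y f x \<theta> - odin_risk_qff \<omega> W \<rho> l t lam \<gamma> \<sigma> y f x \<theta>\<bar>
             / odin_risk \<rho> l t lam \<gamma> \<sigma> y f x \<theta> \<le> \<epsilon>"
proof (intro allI impI)
  fix x \<theta>
  let ?m = "CARD('m)" and ?b = "sqrt 2 / l"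
  let ?R = "odin_risk \<rho> l t lam \<gamma> \<sigma> y f x \<theta>" and ?R' = "odin_risk_qff \<omega> W \<rho> l t lam \<gamma> \<sigma> y f x \<theta>"
  assume nz: "?R \<noteq> 0"
  define P where "P = qff_mat \<rho> l \<omega> W t"
  define P' where "P' = qff_mat_deriv \<rho> l \<omega> W t"
  define \<eta> where "\<eta> = \<rho> * (36 / (2 ^ ?m * (min l 1) ^ 4))"
  \<comment> \<open>Positivity of the first argument of the maximum yields \<open>m \<ge> 10\<close>
    whatever the sign of the logarithm.\<close>
  have "0 < exp 1 / (2 * (min l 1)\<^sup>2)" using assms(5) by simp
  then have "real ?m \<ge> 10" and m: "exp 1 / (2 * (min l 1)\<^sup>2) \<le> real ?m"
    and mlog: "real ?m \<ge> 10 + log 2 ((max \<rho> 1)\<^sup>2 * real CARD('n) ^ 3 /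
              ((min lam 1)\<^sup>2 * min \<gamma> 1 * (min l 1) ^ 4 * \<epsilon>))"
    using assms(12) by linarith+
  then have m2: "?m \<ge> 2" by linarith
  have W: "W $ q > 0" for q using assms(11) by (simp add: gauss_hermite_rule_def)
  have b: "0 < ?b" "?b \<le> 2 * real ?m" using assms(5) quad_error_constant(2)[OF assms(5) m2 m] by auto
  have r: "\<bar>t $ i - t $ j\<bar> \<le> 1" for i j using assms(2)[of i] assms(2)[of j] by auto
  \<comment> \<open>The factor \<open>sqrt pi\<close> of the quadrature error cancels against the
    normalisation \<open>\<rho> / sqrt pi\<close>.\<close>
  have scale: "\<bar>\<rho> / sqrt pi * Q - \<rho> / sqrt pi * I\<bar> \<le> \<eta>"
    if "\<bar>I - Q\<bar> \<le> 16 * (real ?m)\<^sup>2 * ?b ^ (2 * ?m) * sqrt pi * fact ?m / (2 ^ ?m * fact (2 * ?m))" for I Q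
  proof -
    have "\<bar>\<rho> / sqrt pi * Q - \<rho> / sqrt pi * I\<bar> = \<rho> / sqrt pi * \<bar>I - Q\<bar>"
      using abs_mult[of "\<rho> / sqrt pi" "Q - I"] assms(4)
      by (simp only: right_diff_distrib abs_minus_commute[of I Q]) simp
    also have "\<dots> \<le> \<rho> / sqrt pi * (16 * (real ?m)\<^sup>2 * ?b ^ (2 * ?m) * sqrt pi * fact ?m / (2 ^ ?m * fact (2 * ?m)))"
      using that assms(4) by (intro mult_left_mono) auto
    also have "\<dots> = \<rho> * (16 * (real ?m)\<^sup>2 * ?b ^ (2 * ?m) * fact ?m / (2 ^ ?m * fact (2 * ?m)))"
      by simp
    also have "\<dots> \<le> \<eta>"
      unfolding \<eta>_def using assms(4) quad_error_constant(1)[OF assms(5) m2 m] by (intro mult_left_mono) auto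
    finally show ?thesis .
  qed
  note err = quad_error_feature_kernel[OF assms(11) b r, THEN scale]
  have close: "\<bar>(transpose P ** P) $ i $ j - kernel_mat \<rho> l t $ i $ j\<bar> \<le> \<eta>"
    "\<bar>(transpose P ** P') $ i $ j - kernel_mat_dy \<rho> l t $ i $ j\<bar> \<le> \<eta>"
    "\<bar>(transpose P' ** P') $ i $ j - kernel_mat_dxdy \<rho> l t $ i $ j\<bar> \<le> \<eta>" for i j
    unfolding P_def P'_def qff_gram_entries[OF W assms(4)] kernel_mat_def kernel_mat_dy_def kernel_mat_dxdy_def
      vec_lambda_beta deriv_rbf_kernel_eq_gauss_int(3)[OF assms(5)]
    unfolding deriv_rbf_kernel_eq_gauss_int(2)[OF assms(5)]
    unfolding rbf_kernel_eq_gauss_int[OF assms(5)]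
    by (rule err)+
  have n: "4 * real CARD('n) * \<eta> \<le> \<epsilon> * min lam \<gamma>"
    unfolding \<eta>_def by (rule order_suffices) (use assms mlog in auto)
  note compare = risk_form_compare[where x = x and y = y and f = f and \<theta> = \<theta> and \<sigma> = \<sigma>,
      OF transpose_kernel_mats[OF assms(5)] block_form_kernel_nonneg[OF assms(5,4)]
      _ _ _ block_form_gram_nonneg close assms(6,7,9,10) n]
  have "transpose (transpose P ** P) = transpose P ** P" "transpose (transpose P ** P') = transpose P' ** P"
    "transpose (transpose P' ** P') = transpose P' ** P'"
    by (simp_all add: matrix_transpose_mul)
  from compare[OF this] have "0 \<le> ?R" "\<bar>?R - ?R'\<bar> \<le> \<epsilon> * ?R"
    by (simp_all add: odin_risk_def odin_risk_qff_def Let_def P_def P'_def)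
  \<comment> \<open>The risk is nonnegative and nonzero, hence positive, and the inequality can be
    divided by it.\<close>
  with nz show "\<bar>?R - ?R'\<bar> / ?R \<le> \<epsilon>" by (simp add: pos_divide_le_eq)
qed

end
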